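(* Let $q$ be a prime power, $\mathcal A=\mathbb F_q^k$, $\mathcal E$ a finite set, $P=P_{A,E}$ a probability distribution on $\mathcal A\times\mathcal E$ (with $V(P)>0$), $R\in\mathbb R$, and let $p(n)$ be a polynomial (with positive values). Put $\mathsf M_n=\lfloor e^{nH(A|E|P)+\sqrt nR}\rfloor$. When the random linear function $f_{\mathbf X^n}$ from $\mathcal A^n$ to $\{1,\dots,\mathsf M_n\}$ is $p(n)$-almost dual universal$_2$ for each $n$, the relations $$\lim_{n\to\infty}\mathrm E_{\mathbf X^n}d_1'(f_{\mathbf X^n}(A_n)|E_n|P_{A,E}^n)=\lim_{n\to\infty}\min_fd_1'(f(A_n)|E_n|P_{A,E}^n)=2\int_{-\infty}^{R/\sqrt{V(P)}}\frac1{\sqrt{2\pi}}e^{-x^2/2}\,dx$$ hold, where the minimum is over all functions $f$ from $\mathcal A^n$ to $\{1,\dots,\mathsf M_n\}$.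
   Context: Logarithms are natural. $P_{A,E}^n$ is the $n$-fold i.i.d. product distribution of $P_{A,E}$, the joint law of $(A_n,E_n)\in\mathcal A^n\times\mathcal E^n$. $H(A|E|P)=-\sum_{a,e}P_{A,E}(a,e)\log P_{A|E}(a|e)$ with $P_{A|E}(a|e)=P_{A,E}(a,e)/P_E(e)$, $P_E(e)=\sum_aP_{A,E}(a,e)$, and $V(P)=\sum_{a,e}P_{A,E}(a,e)\bigl(-\log P_{A|E}(a|e)-H(A|E|P)\bigr)^2$. For a distribution $P_{A,E}$ and a map $f$ from $\mathcal A$ to a set of $\mathsf M$ elements, $P_{f(A),E}(b,e)=\sum_{a:f(a)=b}P_{A,E}(a,e)$ and $d_1'(f(A)|E|P_{A,E})=\sum_{b,e}|P_{f(A),E}(b,e)-P_E(e)/\mathsf M|$. Hash functions: a random linear function from $\mathbb F_q^N$ to $\{1,\dots,\mathsf M\}$ is understood with $\{1,\dots,\mathsf M\}$ identified with a vector space $\mathbb F_q^m$, $m\le N$. $\mathbf X$ is a random variable (independent of $(A,E)$); for each value $x$, $f_x:\mathbb F_q^N\to\mathbb F_q^m$ is an $\mathbb F_q$-linear map with kernel $C_x$ (of dimension $N-m$ or more), and $C_x^\perp=\{y\in\mathbb F_q^N:\sum_iy_iz_i=0\ \forall z\in C_x\}$ is the dual code. $f_{\mathbf X}$ is $\varepsilon$-almost dual universal$_2$ if the kernels have minimum dimension $\min_x\dim C_x=N-m$ (equivalently, the dual codes have maximum dimension $m$) and $\Pr[y\in C_{\mathbf X}^\perp]\le\varepsilon q^{m-N}$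 for all $y\in\mathbb F_q^N\setminus\{0\}$. Here $N=kn$.
   Formalization: Added: the probability that the random linear function is onto tends to 1 (otherwise mixing in the zero map is a counterexample). Its range is F_q^m with m = floor(log_q M_n), and d_1' uses q^m there, since {1,...,M_n} is a vector space over F_q only if M_n is a power of q. *)

theory Defs
  imports
    "HOL-Probability.Probability"
    "HOL-Computational_Algebra.Polynomial"
    "Jordan_Normal_Form.VS_Connect"
begin

section \<open>Conditional entropy, its variance, and the security criterion\<close>

definition cond_prob :: "('a \<times> 'e) pmf \<Rightarrow> 'a \<Rightarrow> 'e \<Rightarrow> real" where
  "cond_prob P a e = pmf P (a, e) / pmf (map_pmf snd P) e"

text \<open>
  In the next two definitions points with \<open>P(a,e) = 0\<close> contribute \<open>0\<close>, because of the
  leading factor \<open>pmf P (a, e)\<close> (whatever \<open>ln\<close> returns there).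
\<close>

definition cond_ent :: "'a set \<Rightarrow> 'e set \<Rightarrow> ('a \<times> 'e) pmf \<Rightarrow> real" where
  "cond_ent A E P = - (\<Sum>a\<in>A. \<Sum>e\<in>E. pmf P (a, e) * ln (cond_prob P a e))"

definition cond_var :: "'a set \<Rightarrow> 'e set \<Rightarrow> ('a \<times> 'e) pmf \<Rightarrow> real" where
  "cond_var A E P =
     (\<Sum>a\<in>A. \<Sum>e\<in>E. pmf P (a, e) * (- ln (cond_prob P a e) - cond_ent A E P)\<^sup>2)"

text \<open>
  \<open>d1' B E f P\<close> is \<open>d\<^sub>1'(f(A)|E|P)\<close> for a map \<open>f\<close> into the finite set \<open>B\<close>; the number
  \<open>card B\<close> is the \<open>M\<close> of the uniform distribution on the range.
\<close>

definition d1' :: "'b set \<Rightarrow> 'e set \<Rightarrow> ('a \<Rightarrow> 'b) \<Rightarrow> ('a \<times> 'e) pmf \<Rightarrow> real" where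
  "d1' B E f P =
     (\<Sum>b\<in>B. \<Sum>e\<in>E. \<bar>pmf (map_pmf (map_prod f id) P) (b, e)
                         - pmf (map_pmf snd P) e / real (card B)\<bar>)"


section \<open>Product distributions\<close>

text \<open>
  A block in \<open>(F\<^sub>q\<^sup>k)\<^sup>n\<close> is identified with a vector in \<open>F\<^sub>q\<^bsup>kn\<^esup>\<close> by concatenation, so that
  \<open>iid_pmf n P\<close> lives on \<open>carrier_vec (k * n) \<times> {es. length es = n}\<close> when \<open>P\<close> lives on
  \<open>carrier_vec k \<times> UNIV\<close>.
\<close>

definition flatten_vecs :: "'f vec list \<Rightarrow> 'f vec" where
  "flatten_vecs vs = vec_of_list (concat (map list_of_vec vs))"

definition iid_pmf :: "nat \<Rightarrow> ('f vec \<times> 'e) pmf \<Rightarrow> ('f vec \<times> 'e list) pmf" where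
  "iid_pmf n P =
     map_pmf (\<lambda>xs. (flatten_vecs (map fst xs), map snd xs)) (replicate_pmf n P)"


section \<open>Random linear hash functions\<close>

definition hash_kernel :: "nat \<Rightarrow> nat \<Rightarrow> ('f::field vec \<Rightarrow> 'f vec) \<Rightarrow> 'f vec set" where
  "hash_kernel N m f = {v \<in> carrier_vec N. f v = 0\<^sub>v m}"

definition dual_code :: "nat \<Rightarrow> 'f::field vec set \<Rightarrow> 'f vec set" where
  "dual_code N C = {y \<in> carrier_vec N. \<forall>z\<in>C. y \<bullet> z = 0}"

definition code_dim :: "nat \<Rightarrow> 'f::field vec set \<Rightarrow> nat" where
  "code_dim N C =
     vectorspace.dim (class_ring :: 'f ring) ((module_vec TYPE('f) N)\<lparr>carrier := C\<rparr>)"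

text \<open>
  The random seed is a \<open>pmf\<close>; no generality is lost, since there are only finitely many linear
  maps from \<open>F\<^sub>q\<^sup>N\<close> to \<open>F\<^sub>q\<^sup>m\<close>. The image of \<open>set_pmf X\<close> below is a finite set of numbers \<open>\<le> N\<close>
  even if \<open>set_pmf X\<close> itself is infinite.

  Only the minimum of the kernel dimensions is prescribed. So a positive fraction of the maps may
  fail to be onto: the zero map has dual code \<open>{0}\<close> and never contributes to the probability
  bound, although its \<open>d\<^sub>1'\<close> is close to \<open>2\<close>. Statements that need (asymptotic) surjectivity have
  to assume it separately.
\<close>

definition almost_dual_universal2 ::
  "real \<Rightarrow> nat \<Rightarrow> nat \<Rightarrow> 's pmf \<Rightarrow> ('s \<Rightarrow> 'f::{field,finite} vec \<Rightarrow> 'f vec) \<Rightarrow> bool" where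
  "almost_dual_universal2 \<epsilon> N m X f \<longleftrightarrow>
     m \<le> N \<and>
     (\<forall>x\<in>set_pmf X.
        linear_map class_ring (module_vec TYPE('f) N) (module_vec TYPE('f) m) (f x)) \<and>
     Min ((\<lambda>x. code_dim N (hash_kernel N m (f x))) ` set_pmf X) = N - m \<and>
     (\<forall>y\<in>carrier_vec N - {0\<^sub>v N}.
        measure_pmf.prob X {x. y \<in> dual_code N (hash_kernel N m (f x))}
          \<le> \<epsilon> * real CARD('f) powi (int m - int N))"


section \<open>Second-order key length\<close>

definition key_size :: "real \<Rightarrow> real \<Rightarrow> nat \<Rightarrow> nat" where
  "key_size H R n = nat \<lfloor>exp (real n * H + sqrt (real n) * R)\<rfloor>"

text \<open>
  The range \<open>{1..M}\<close> can be identified with a vector space over a field of \<open>q\<close> elements only if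
  \<open>M\<close> is a power of \<open>q\<close>. In general the vector space used has dimension \<open>key_dim q M\<close>, the
  largest \<open>m\<close> with \<open>q ^ m \<le> M\<close> (for \<open>M \<ge> 1\<close>, \<open>q \<ge> 2\<close>); it has exactly \<open>M\<close> elements whenever
  that is possible.
\<close>

definition key_dim :: "nat \<Rightarrow> nat \<Rightarrow> nat" where
  "key_dim q M = nat \<lfloor>log (real q) (real M)\<rfloor>"

end

theory Submission
  imports Defs "HOL-Real_Asymp.Real_Asymp"
begin

text \<open>
  Let \<open>G(c)\<close> be the probability that \<open>P(a|e) > c / M\<close> under the product distribution. At most
  \<open>M / c\<close> points \<open>a\<close> satisfy this for a given \<open>e\<close>, so every map into \<open>M\<close> values squeezes mass
  \<open>G(c)\<close> into a fraction \<open>1 / c\<close> of its range, whence \<open>d\<^sub>1' \<ge> 2 (G(c) - 1 / c)\<close>. Conversely,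
  discarding these points costs at most \<open>2 G(c)\<close>, and by Cauchy-Schwarz the rest of the distribution
  contributes at most the square root of its excess collision probability. That excess is at most
  \<open>c\<close> for a greedily chosen map, and \<open>p(n) c\<close> on average for a \<open>p(n)\<close>-almost dual universal family,
  by duality. Taking \<open>c = n\<close> in the lower bound and \<open>c\<close> the power of \<open>n\<close> with exponent \<open>- deg p - 1\<close>
  in the upper bound (exponent \<open>- 1\<close> for the greedy map), \<open>ln c\<close> is negligible against \<open>sqrt n\<close>, and
  the central limit theorem gives the same limit of \<open>G(c)\<close> in all cases.
\<close>

unbundle no inner_syntax
unbundle no vec_syntax

section \<open>Linear maps and dual codes\<close>

text \<open>Universality controls only how often a nonzero vector falls into the dual code. A map
  that is not onto has a transpose with nontrivial kernel, and every nonzero \<open>u\<close> in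
  that kernel adds a full squared mass to the collision count, which this control does not see. So
  the collision estimate carries an indicator of surjectivity, the remaining seeds are charged the
  trivial bound 2, and their probability tends to 0 by hypothesis. The cut has to be made at the
  conditional probability: Cauchy-Schwarz is weighted by the marginal of the side information, and
  after division by that marginal the light points have a sum of squares at most equal to the
  threshold. Three perturbations of the threshold occur: the factor \<open>c\<close>, the floor in
  \<open>key_size\<close>, and the passage from \<open>M\<close> to a power of \<open>q\<close>.
  Each changes its logarithm by a constant or a multiple of \<open>ln n\<close>, hence by o(sqrt n),
  which the second-order scale ignores. For the same reason a polynomial loss in universality is
  harmless.\<close>

lemma vec_of_list_bij_betw:
  "bij_betw vec_of_list {xs :: 'a list. length xs = n} (carrier_vec n)"
  by (rule bij_betw_byWitness[where f' = list_of_vec])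
    (auto simp: list_vec vec_list intro!: carrier_vecI)

lemma finite_carrier_vec [simp]: "finite (carrier_vec n :: 'a::finite vec set)"
proof -
  have "finite {xs :: 'a list. length xs = n}"
    using finite_lists_length_eq[of "UNIV :: 'a set" n] by simp
  then show ?thesis by (metis vec_of_list_bij_betw bij_betw_finite)
qed

lemma card_carrier_vec: "card (carrier_vec n :: 'a::finite vec set) = CARD('a) ^ n"
  using bij_betw_same_card[OF vec_of_list_bij_betw[where 'a = 'a and n = n]]
    card_lists_length_eq[of "UNIV :: 'a set" n] by simp

text \<open>
  The average of a nontrivial additive character over all nonzero multiples of \<open>t\<close>; unlike the
  character itself it is real, and its orthogonality relations suffice for Parseval's identity.
\<close>

definition avg_char :: "'f::{field,finite} \<Rightarrow> real" where
  "avg_char t = (if t = 0 then 1 else - 1 / (real CARD('f) - 1))"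

lemma card_field_ge_2: "2 \<le> CARD('f::{field,finite})"
proof -
  have "card {0, 1 :: 'f} \<le> CARD('f)" by (rule card_mono) auto
  then show ?thesis by simp
qed

text \<open>Being affine in the indicator of \<open>t = 0\<close>, the averaged character reduces to
  counting coincidences.\<close>

lemma avg_char_alt:
  "avg_char (t :: 'f::{field,finite}) = (real CARD('f) * of_bool (t = 0) - 1) / (real CARD('f) - 1)"
  using card_field_ge_2[where 'f = 'f] by (auto simp: avg_char_def)

lemma sum_avg_char: "(\<Sum>t\<in>UNIV. avg_char (t + s)) = 0"
  for s :: "'f::{field,finite}"
proof -
  have "(\<Sum>t\<in>UNIV. of_bool (t + s = 0) :: real) = (\<Sum>t\<in>{- s}. 1)"
    by (rule sum.mono_neutral_cong_right) (auto simp: eq_neg_iff_add_eq_0)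
  then have "(\<Sum>t\<in>UNIV. real CARD('f) * of_bool (t + s = 0) - 1) = 0"
    by (simp add: sum_subtractf flip: sum_distrib_left)
  then show ?thesis by (simp add: avg_char_alt flip: sum_divide_distrib)
qed

lemma sum_avg_char_scalar_prod:
  assumes z: "(z :: 'f::{field,finite} vec) \<in> carrier_vec m"
  shows "(\<Sum>u\<in>carrier_vec m. avg_char (u \<bullet> z)) = (if z = 0\<^sub>v m then real CARD('f) ^ m else 0)"
proof (cases "z = 0\<^sub>v m")
  case True
  then show ?thesis by (simp add: avg_char_def card_carrier_vec)
next
  case False
  then obtain i where i: "i < m" "z $ i \<noteq> 0" using z by (metis carrier_vecD eq_vecI index_zero_vec)
  have shift: "(\<Sum>u\<in>carrier_vec m. avg_char (u \<bullet> z)) = (\<Sum>u\<in>carrier_vec m. avg_char (s + u \<bullet> z))" for s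
  proof -
    define v where "v = (s / z $ i) \<cdot>\<^sub>v unit_vec m i"
    have v: "v \<in> carrier_vec m" by (simp add: v_def)
    have vz: "v \<bullet> z = s" using i z by (simp add: v_def)
    show ?thesis
    proof (rule sum.reindex_bij_witness[of _ "\<lambda>u. v + u" "\<lambda>u. u - v"])
      fix a :: "'f vec" assume "a \<in> carrier_vec m"
      then show "v + (a - v) = a" "v + a - v = a" using v by (auto intro!: eq_vecI)
      have "(a - v) \<bullet> z = a \<bullet> z - s"
        using \<open>a \<in> carrier_vec m\<close> v vz z by (simp add: minus_scalar_prod_distrib)
      then show "avg_char (s + (a - v) \<bullet> z) = avg_char (a \<bullet> z)" by simp
    qed (use v in auto)
  qed
  have "real CARD('f) * (\<Sum>u\<in>carrier_vec m. avg_char (u \<bullet> z))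
      = (\<Sum>s\<in>(UNIV :: 'f set). \<Sum>u\<in>carrier_vec m. avg_char (s + u \<bullet> z))"
    by (simp flip: shift)
  also have "\<dots> = (\<Sum>u\<in>carrier_vec m. \<Sum>s\<in>UNIV. avg_char (s + u \<bullet> z))" by (rule sum.swap)
  also have "\<dots> = 0" by (simp add: sum_avg_char)
  finally show ?thesis using False by simp
qed

section \<open>Quadratic forms of collisions and characters\<close>

lemma sum_collision_eq_sum_squares:
  fixes w :: "'a \<Rightarrow> real"
  assumes "finite A" "finite B" "f ` A \<subseteq> B"
  shows "(\<Sum>a\<in>A. \<Sum>a'\<in>A. w a * w a' * of_bool (f a = f a')) = (\<Sum>b\<in>B. (\<Sum>a | a \<in> A \<and> f a = b. w a)\<^sup>2)"
proof -
  have "(\<Sum>b\<in>B. (\<Sum>a | a \<in> A \<and> f a = b. w a)\<^sup>2)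
      = (\<Sum>b\<in>B. \<Sum>a | a \<in> A \<and> f a = b. w a * (\<Sum>a' | a' \<in> A \<and> f a' = b. w a'))"
    by (simp add: power2_eq_square sum_distrib_right)
  also have "\<dots> = (\<Sum>b\<in>B. \<Sum>a | a \<in> A \<and> f a = b. w a * (\<Sum>a' | a' \<in> A \<and> f a' = f a. w a'))"
    by (intro sum.cong) auto
  also have "\<dots> = (\<Sum>a\<in>A. w a * (\<Sum>a' | a' \<in> A \<and> f a' = f a. w a'))"
    using assms by (intro sum.group) auto
  also have "\<dots> = (\<Sum>a\<in>A. \<Sum>a'\<in>A. w a * w a' * of_bool (f a = f a'))"
  proof (rule sum.cong)
    fix a assume "a \<in> A"
    have "(\<Sum>a' | a' \<in> A \<and> f a' = f a. w a') = (\<Sum>a'\<in>A. w a' * of_bool (f a = f a'))"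
      using assms by (intro sum.mono_neutral_cong_left) auto
    then show "w a * (\<Sum>a' | a' \<in> A \<and> f a' = f a. w a') = (\<Sum>a'\<in>A. w a * w a' * of_bool (f a = f a'))"
      by (simp add: sum_distrib_left mult.assoc)
  qed simp
  finally show ?thesis ..
qed

text \<open>The counterpart of the squared modulus of a Fourier coefficient. Grouping the weights by
  the value of \<open>g\<close> reduces the claim to Cauchy-Schwarz over the \<open>q\<close> field
  elements. Nonnegativity is what later permits enlarging the set of dual vectors that is summed
  over.\<close>

lemma sum_avg_char_nonneg:
  fixes w :: "'a \<Rightarrow> real" and g :: "'a \<Rightarrow> 'f::{field,finite}"
  assumes "finite A"
  shows "0 \<le> (\<Sum>a\<in>A. \<Sum>a'\<in>A. w a * w a' * avg_char (g a - g a'))"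
proof -
  define q where "q = real CARD('f)"
  have q: "q \<ge> 2" using card_field_ge_2[where 'f = 'f] by (simp add: q_def)
  have "(\<Sum>a\<in>A. w a)\<^sup>2 = (\<Sum>t\<in>UNIV. \<Sum>a | a \<in> A \<and> g a = t. w a)\<^sup>2"
    using assms by (simp add: sum.group)
  also have "\<dots> \<le> q * (\<Sum>t\<in>UNIV. (\<Sum>a | a \<in> A \<and> g a = t. w a)\<^sup>2)"
    unfolding q_def using sum_squared_le_sum_of_squares[of "\<lambda>t. \<Sum>a | a \<in> A \<and> g a = t. w a" "UNIV :: 'f set"] by (simp add: mult.commute)
  also have "\<dots> = q * (\<Sum>a\<in>A. \<Sum>a'\<in>A. w a * w a' * of_bool (g a = g a'))"
    using assms by (subst sum_collision_eq_sum_squares[where B = UNIV]) auto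
  finally have *: "0 \<le> q * (\<Sum>a\<in>A. \<Sum>a'\<in>A. w a * w a' * of_bool (g a = g a')) - (\<Sum>a\<in>A. w a)\<^sup>2"
    by simp
  have "(\<Sum>a\<in>A. \<Sum>a'\<in>A. w a * w a' * avg_char (g a - g a'))
      = (\<Sum>a\<in>A. \<Sum>a'\<in>A. (q * (w a * w a' * of_bool (g a = g a')) - w a * w a') / (q - 1))"
    by (simp add: avg_char_alt algebra_simps q_def)
  also have "\<dots> = (q * (\<Sum>a\<in>A. \<Sum>a'\<in>A. w a * w a' * of_bool (g a = g a')) - (\<Sum>a\<in>A. w a)\<^sup>2) / (q - 1)"
    unfolding sum_divide_distrib[symmetric] sum_subtractf sum_distrib_left[symmetric]
      power2_eq_square sum_product
    by (simp flip: sum_distrib_left sum_distrib_right)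
  finally show ?thesis using * q by simp
qed

section \<open>Linear maps over a finite field and their transposes\<close>

lemma linear_map_vecD:
  assumes "linear_map class_ring (module_vec TYPE('f::field) N) (module_vec TYPE('f) m) h"
  shows "v \<in> carrier_vec N \<Longrightarrow> h v \<in> carrier_vec m"
    and "u \<in> carrier_vec N \<Longrightarrow> v \<in> carrier_vec N \<Longrightarrow> h (u + v) = h u + h v"
    and "v \<in> carrier_vec N \<Longrightarrow> h (c \<cdot>\<^sub>v v) = c \<cdot>\<^sub>v h v"
proof -
  interpret linear_map class_ring "module_vec TYPE('f) N" "module_vec TYPE('f) m" h by fact
  show "v \<in> carrier_vec N \<Longrightarrow> h v \<in> carrier_vec m"
    and "u \<in> carrier_vec N \<Longrightarrow> v \<in> carrier_vec N \<Longrightarrow> h (u + v) = h u + h v"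
    and "v \<in> carrier_vec N \<Longrightarrow> h (c \<cdot>\<^sub>v v) = c \<cdot>\<^sub>v h v"
    using f_im f_add f_smult by (simp_all add: module_vec_simps class_ring_simps)
qed

lemma diff_eq_zero_vec_iff:
  assumes "(a :: 'a::group_add vec) \<in> carrier_vec n" "b \<in> carrier_vec n"
  shows "a - b = 0\<^sub>v n \<longleftrightarrow> a = b"
proof
  assume *: "a - b = 0\<^sub>v n"
  have "a $ i = b $ i" if "i < n" for i
    using arg_cong[OF *, of "\<lambda>v. v $ i"] that assms by simp
  then show "a = b" using assms by (intro eq_vecI) auto
qed (use assms in simp)

definition transpose_map :: "nat \<Rightarrow> nat \<Rightarrow> ('f::field vec \<Rightarrow> 'f vec) \<Rightarrow> 'f vec \<Rightarrow> 'f vec" where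
  "transpose_map N m h u = vec N (\<lambda>i. u \<bullet> h (unit_vec N i))"

context
  fixes N m :: nat and h :: "'f::{field,finite} vec \<Rightarrow> 'f vec"
  assumes linear: "linear_map class_ring (module_vec TYPE('f) N) (module_vec TYPE('f) m) h"
begin

lemma scalar_prod_linear_map:
  assumes u: "u \<in> carrier_vec m" and z: "z \<in> carrier_vec N"
  shows "u \<bullet> h z = transpose_map N m h u \<bullet> z"
proof -
  note lin = linear_map_vecD[OF linear]
  \<comment> \<open>Truncation to the first \<open>l\<close> coordinates: induction on
    \<open>l\<close> rebuilds \<open>z\<close> by one multiple of a unit vector at a time.\<close>
  define tr where "tr l = vec N (\<lambda>i. if i < l then z $ i else 0)" for l
  have tr: "tr l \<in> carrier_vec N" for l by (simp add: tr_def)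
  have "u \<bullet> h (tr l) = (\<Sum>i<l. (u \<bullet> h (unit_vec N i)) * z $ i)" if "l \<le> N" for l
    using that
  proof (induction l)
    case 0
    have "tr 0 = 0 \<cdot>\<^sub>v tr 0" by (auto simp: tr_def)
    then have "h (tr 0) = h (0 \<cdot>\<^sub>v tr 0)" by (rule arg_cong)
    also have "\<dots> = 0 \<cdot>\<^sub>v h (tr 0)" using lin(3)[OF tr] .
    finally have "u \<bullet> h (tr 0) = u \<bullet> (0 \<cdot>\<^sub>v h (tr 0))" by (rule arg_cong)
    then show ?case using u lin(1)[OF tr] by simp
  next
    case (Suc l)
    have "tr (Suc l) = tr l + z $ l \<cdot>\<^sub>v unit_vec N l"
      using Suc.prems by (intro eq_vecI) (auto simp: tr_def less_Suc_eq)
    then have "h (tr (Suc l)) = h (tr l) + z $ l \<cdot>\<^sub>v h (unit_vec N l)"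
      using lin(2)[OF tr] lin(3) by simp
    then show ?case using Suc u lin(1)[OF tr] lin(1)[OF unit_vec_carrier]
      by (simp add: scalar_prod_add_distrib)
  qed
  moreover have tr_N: "tr N = z" using z by (intro eq_vecI) (auto simp: tr_def)
  ultimately have "u \<bullet> h z = (\<Sum>i<N. (u \<bullet> h (unit_vec N i)) * z $ i)"
    by (metis order_refl)
  also have "\<dots> = (\<Sum>i<N. transpose_map N m h u $ i * z $ i)"
    by (simp add: transpose_map_def)
  also have "\<dots> = transpose_map N m h u \<bullet> z"
    using z by (simp add: scalar_prod_def lessThan_atLeast0)
  finally show ?thesis .
qed

text \<open>By adjointness, pairing with a kernel vector gives \<open>u \<bullet> 0 = 0\<close>.
  This is how dual codes enter: the frequencies that occur in the Fourier expansion of a collision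
  are transposes, hence dual codewords.\<close>

lemma transpose_map_in_dual_code:
  assumes "u \<in> carrier_vec m"
  shows "transpose_map N m h u \<in> dual_code N (hash_kernel N m h)"
proof -
  have "transpose_map N m h u \<bullet> z = 0" if "z \<in> carrier_vec N" "h z = 0\<^sub>v m" for z
    using scalar_prod_linear_map[OF assms that(1)] that assms by simp
  then show ?thesis by (auto simp: dual_code_def hash_kernel_def transpose_map_def)
qed

lemma linear_map_eq_iff:
  assumes "a \<in> carrier_vec N" "a' \<in> carrier_vec N"
  shows "h a = h a' \<longleftrightarrow> h (a - a') = 0\<^sub>v m"
proof -
  have "a - a' = a + (- 1) \<cdot>\<^sub>v a'"
    using assms by (intro eq_vecI) auto
  then have "h (a - a') = h a + (- 1) \<cdot>\<^sub>v h a'"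
    using assms linear_map_vecD(2,3)[OF linear] by simp
  also have "\<dots> = h a - h a'"
    using assms linear_map_vecD(1)[OF linear] by (intro eq_vecI) auto
  finally show ?thesis
    using diff_eq_zero_vec_iff[OF linear_map_vecD(1)[OF linear] linear_map_vecD(1)[OF linear]] assms by simp
qed

text \<open>Surjectivity enters here: \<open>u\<close> is determined by its pairings with all
  vectors, and each of these is a value of \<open>h\<close>.\<close>

lemma inj_on_transpose_map:
  assumes onto: "h ` carrier_vec N = carrier_vec m"
  shows "inj_on (transpose_map N m h) (carrier_vec m)"
proof (rule inj_onI)
  fix u v assume u: "u \<in> carrier_vec m" and v: "v \<in> carrier_vec m"
    and eq: "transpose_map N m h u = transpose_map N m h v"
  have "u \<bullet> w = v \<bullet> w" if w: "w \<in> carrier_vec m" for w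
    using w eq u v scalar_prod_linear_map unfolding onto[symmetric] by auto
  then have "u \<bullet> unit_vec m i = v \<bullet> unit_vec m i" for i by simp
  then have "u $ i = v $ i" if "i < m" for i
    using that u v scalar_prod_right_unit by metis
  then show "u = v" using u v by (intro eq_vecI) auto
qed

text \<open>Orthogonality expands the event \<open>h a = h a'\<close>, that is
  \<open>h (a - a') = 0\<close>, over all frequencies \<open>u\<close>. Moving \<open>h\<close> to
  the other side of the scalar product turns these into the vectors \<open>?T u\<close>. The term of
  \<open>u = 0\<close> is exactly the square that is subtracted.\<close>

lemma collision_excess_le_dual_code_sum:
  fixes w :: "'f vec \<Rightarrow> real"
  assumes onto: "h ` carrier_vec N = carrier_vec m"
  shows "real CARD('f) ^ m * (\<Sum>a\<in>carrier_vec N. \<Sum>a'\<in>carrier_vec N. w a * w a' * of_bool (h a = h a'))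
       - (\<Sum>a\<in>carrier_vec N. w a)\<^sup>2
    \<le> (\<Sum>y\<in>carrier_vec N - {0\<^sub>v N}. of_bool (y \<in> dual_code N (hash_kernel N m h)) *
         (\<Sum>a\<in>carrier_vec N. \<Sum>a'\<in>carrier_vec N. w a * w a' * avg_char (y \<bullet> a - y \<bullet> a')))"
    (is "_ \<le> (\<Sum>y\<in>_. _ * ?B y)")
proof -
  let ?C = "carrier_vec N :: 'f vec set" and ?T = "transpose_map N m h"
  have T0: "?T (0\<^sub>v m) = 0\<^sub>v N"
    using linear_map_vecD(1)[OF linear] by (auto simp: transpose_map_def)
  have T: "?T u \<in> ?C" for u by (simp add: transpose_map_def)
  have collision: "real CARD('f) ^ m * of_bool (h a = h a') = (\<Sum>u\<in>carrier_vec m. avg_char (?T u \<bullet> a - ?T u \<bullet> a'))"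
    if a: "a \<in> ?C" "a' \<in> ?C" for a a'
  proof -
    have "real CARD('f) ^ m * of_bool (h a = h a') = (\<Sum>u\<in>carrier_vec m. avg_char (u \<bullet> h (a - a')))"
      using a by (subst sum_avg_char_scalar_prod) (auto simp: linear_map_eq_iff linear_map_vecD(1)[OF linear])
    also have "\<dots> = (\<Sum>u\<in>carrier_vec m. avg_char (?T u \<bullet> a - ?T u \<bullet> a'))"
      using a T by (intro sum.cong) (simp_all add: scalar_prod_linear_map scalar_prod_minus_distrib[OF T])
    finally show ?thesis .
  qed
  have "real CARD('f) ^ m * (\<Sum>a\<in>?C. \<Sum>a'\<in>?C. w a * w a' * of_bool (h a = h a'))
      = (\<Sum>a\<in>?C. \<Sum>a'\<in>?C. \<Sum>u\<in>carrier_vec m. w a * w a' * avg_char (?T u \<bullet> a - ?T u \<bullet> a'))"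
    unfolding sum_distrib_left
    by (intro sum.cong refl) (simp only: mult.left_commute[of "real CARD('f) ^ m"] collision sum_distrib_left)
  also have "\<dots> = (\<Sum>a\<in>?C. \<Sum>u\<in>carrier_vec m. \<Sum>a'\<in>?C. w a * w a' * avg_char (?T u \<bullet> a - ?T u \<bullet> a'))"
    by (intro sum.cong[OF refl] sum.swap)
  also have "\<dots> = (\<Sum>u\<in>carrier_vec m. ?B (?T u))"
    by (rule sum.swap)
  also have "\<dots> = ?B (?T (0\<^sub>v m)) + (\<Sum>u\<in>carrier_vec m - {0\<^sub>v m}. ?B (?T u))"
    by (rule sum.remove) auto
  also have "?B (?T (0\<^sub>v m)) = (\<Sum>a\<in>?C. w a)\<^sup>2"
    by (simp add: T0 avg_char_def power2_eq_square sum_product cong: sum.cong)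
  finally have *: "real CARD('f) ^ m * (\<Sum>a\<in>?C. \<Sum>a'\<in>?C. w a * w a' * of_bool (h a = h a')) - (\<Sum>a\<in>?C. w a)\<^sup>2
      = (\<Sum>u\<in>carrier_vec m - {0\<^sub>v m}. ?B (?T u))" by simp
  define B where "B = ?B"
  have B: "0 \<le> B y" for y unfolding B_def by (intro sum_avg_char_nonneg) simp
  have inj: "inj_on ?T (carrier_vec m)" using inj_on_transpose_map[OF onto] .
  have "(\<Sum>u\<in>carrier_vec m - {0\<^sub>v m}. B (?T u)) = (\<Sum>y\<in>?T ` (carrier_vec m - {0\<^sub>v m}). B y)"
    by (simp add: sum.reindex[OF inj_on_subset[OF inj Diff_subset]])
  \<comment> \<open>The images of nonzero \<open>u\<close> are distinct and nonzero by injectivity;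
    passing to all nonzero dual vectors only adds nonnegative terms.\<close>
  also have "\<dots> \<le> (\<Sum>y\<in>{y \<in> ?C - {0\<^sub>v N}. y \<in> dual_code N (hash_kernel N m h)}. B y)"
  proof (rule sum_mono2)
    have "?T u \<noteq> 0\<^sub>v N" if "u \<in> carrier_vec m" "u \<noteq> 0\<^sub>v m" for u
      using inj_onD[OF inj _ that(1), of "0\<^sub>v m"] that(2) T0 by auto
    then show "?T ` (carrier_vec m - {0\<^sub>v m}) \<subseteq> {y \<in> ?C - {0\<^sub>v N}. y \<in> dual_code N (hash_kernel N m h)}"
      using T transpose_map_in_dual_code by auto
  qed (simp_all add: B)
  also have "\<dots> = (\<Sum>y\<in>?C - {0\<^sub>v N}. of_bool (y \<in> dual_code N (hash_kernel N m h)) * B y)"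
    by (rule sum.mono_neutral_cong_left) auto
  finally show ?thesis unfolding * B_def .
qed

end

text \<open>Parseval's identity: summing over \<open>y\<close> first leaves only the diagonal
  \<open>a = a'\<close>.\<close>

lemma sum_avg_char_quadratic:
  fixes w :: "'f::{field,finite} vec \<Rightarrow> real"
  shows "(\<Sum>y\<in>carrier_vec N. \<Sum>a\<in>carrier_vec N. \<Sum>a'\<in>carrier_vec N. w a * w a' * avg_char (y \<bullet> a - y \<bullet> a'))
    = real CARD('f) ^ N * (\<Sum>a\<in>carrier_vec N. (w a)\<^sup>2)"
proof -
  let ?C = "carrier_vec N :: 'f vec set"
  have "(\<Sum>y\<in>?C. \<Sum>a\<in>?C. \<Sum>a'\<in>?C. w a * w a' * avg_char (y \<bullet> a - y \<bullet> a'))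
      = (\<Sum>a\<in>?C. \<Sum>y\<in>?C. \<Sum>a'\<in>?C. w a * w a' * avg_char (y \<bullet> a - y \<bullet> a'))"
    by (rule sum.swap)
  also have "\<dots> = (\<Sum>a\<in>?C. \<Sum>a'\<in>?C. \<Sum>y\<in>?C. w a * w a' * avg_char (y \<bullet> a - y \<bullet> a'))"
    by (intro sum.cong[OF refl] sum.swap)
  also have "\<dots> = (\<Sum>a\<in>?C. \<Sum>a'\<in>?C. \<Sum>y\<in>?C. w a * w a' * avg_char (y \<bullet> (a - a')))"
    by (intro sum.cong refl) (simp add: scalar_prod_minus_distrib)
  also have "\<dots> = (\<Sum>a\<in>?C. \<Sum>a'\<in>?C. w a * w a' * (if a = a' then real CARD('f) ^ N else 0))"
    by (intro sum.cong refl) (simp add: sum_avg_char_scalar_prod diff_eq_zero_vec_iff flip: sum_distrib_left)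
  also have "\<dots> = real CARD('f) ^ N * (\<Sum>a\<in>?C. (w a)\<^sup>2)"
    by (simp add: if_distrib power2_eq_square sum_distrib_left mult_ac cong: if_cong)
  finally show ?thesis .
qed

text \<open>On average the indicator of a dual codeword becomes its probability, at most
  \<open>\<epsilon>\<close> times \<open>q\<close> to the power \<open>m - N\<close>; Parseval
  contributes \<open>q ^ N\<close>, and \<open>q ^ m\<close> remains. The surjectivity indicator
  confines the pointwise bound to the seeds where it holds.\<close>

lemma expectation_collision_excess_le:
  fixes h :: "'s \<Rightarrow> 'f::{field,finite} vec \<Rightarrow> 'f vec" and w :: "'f vec \<Rightarrow> real"
  assumes adu: "almost_dual_universal2 \<epsilon> N m X h" and \<epsilon>: "\<epsilon> \<ge> 0"
  shows "measure_pmf.expectation X (\<lambda>x. of_bool (h x ` carrier_vec N = carrier_vec m) *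
      (real CARD('f) ^ m * (\<Sum>a\<in>carrier_vec N. \<Sum>a'\<in>carrier_vec N. w a * w a' * of_bool (h x a = h x a'))
        - (\<Sum>a\<in>carrier_vec N. w a)\<^sup>2))
    \<le> \<epsilon> * real CARD('f) ^ m * (\<Sum>a\<in>carrier_vec N. (w a)\<^sup>2)"
proof -
  let ?C = "carrier_vec N :: 'f vec set"
  define B where "B y = (\<Sum>a\<in>?C. \<Sum>a'\<in>?C. w a * w a' * avg_char (y \<bullet> a - y \<bullet> a'))" for y
  have B: "B y \<ge> 0" for y unfolding B_def by (intro sum_avg_char_nonneg) simp
  let ?D = "\<lambda>x. dual_code N (hash_kernel N m (h x))"
  let ?Z = "\<lambda>x. of_bool (h x ` carrier_vec N = carrier_vec m) *
      (real CARD('f) ^ m * (\<Sum>a\<in>?C. \<Sum>a'\<in>?C. w a * w a' * of_bool (h x a = h x a')) - (\<Sum>a\<in>?C. w a)\<^sup>2)"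
  let ?q = "real CARD('f)"
  have q: "?q \<ge> 2" using card_field_ge_2[where 'f = 'f] by simp
  have prob: "measure_pmf.prob X {x. y \<in> ?D x} \<le> \<epsilon> * ?q powi (int m - int N)" if "y \<in> ?C - {0\<^sub>v N}" for y
    using adu that unfolding almost_dual_universal2_def by blast
  have int_dual: "integrable X (\<lambda>x. of_bool (y \<in> ?D x) * B y)" for y
    by (rule measure_pmf.integrable_const_bound[where B = "B y"]) (auto simp: B)
  have exp_dual: "measure_pmf.expectation X (\<lambda>x. of_bool (y \<in> ?D x)) = measure_pmf.prob X {x. y \<in> ?D x}" for y
  proof -
    have "(\<lambda>x. of_bool (y \<in> ?D x) :: real) = indicator {x. y \<in> ?D x}" by (auto simp: indicator_def)
    then show ?thesis by simp
  qed
  have "measure_pmf.expectation X ?Z \<le> measure_pmf.expectation X (\<lambda>x. \<Sum>y\<in>?C - {0\<^sub>v N}. of_bool (y \<in> ?D x) * B y)"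
  proof (rule integral_mono_AE)
    \<comment> \<open>The seed may have infinite support, so integrability is derived from a bound
      uniform in \<open>x\<close>.\<close>
    have fin: "\<bar>?Z x\<bar> \<le> ?q ^ m * (\<Sum>a\<in>?C. \<Sum>a'\<in>?C. \<bar>w a * w a'\<bar>) + (\<Sum>a\<in>?C. w a)\<^sup>2" for x
    proof -
      let ?S = "\<Sum>a\<in>?C. \<Sum>a'\<in>?C. w a * w a' * of_bool (h x a = h x a')"
      have "\<bar>?S\<bar> \<le> (\<Sum>a\<in>?C. \<Sum>a'\<in>?C. \<bar>w a * w a'\<bar>)"
        by (intro order_trans[OF sum_abs] sum_mono order_trans[OF sum_abs]) auto
      then have "\<bar>?q ^ m * ?S\<bar> \<le> ?q ^ m * (\<Sum>a\<in>?C. \<Sum>a'\<in>?C. \<bar>w a * w a'\<bar>)"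
        by (simp add: abs_mult)
      then have "\<bar>?q ^ m * ?S - (\<Sum>a\<in>?C. w a)\<^sup>2\<bar> \<le> ?q ^ m * (\<Sum>a\<in>?C. \<Sum>a'\<in>?C. \<bar>w a * w a'\<bar>) + (\<Sum>a\<in>?C. w a)\<^sup>2"
        using abs_triangle_ineq4[of "?q ^ m * ?S" "(\<Sum>a\<in>?C. w a)\<^sup>2"] by simp
      then show ?thesis by (auto simp: of_bool_def intro: order_trans[OF abs_ge_zero])
    qed
    show "integrable X ?Z"
      by (rule measure_pmf.integrable_const_bound[OF AE_I2]) (unfold real_norm_def, rule fin, simp)
    show "integrable X (\<lambda>x. \<Sum>y\<in>?C - {0\<^sub>v N}. of_bool (y \<in> ?D x) * B y)"
      using int_dual by (intro Bochner_Integration.integrable_sum)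
    have "?Z x \<le> (\<Sum>y\<in>?C - {0\<^sub>v N}. of_bool (y \<in> ?D x) * B y)" if "x \<in> set_pmf X" for x
    proof (cases "h x ` carrier_vec N = carrier_vec m")
      case True
      then show ?thesis
        using collision_excess_le_dual_code_sum[of N m "h x" w] adu that
        by (simp add: B_def almost_dual_universal2_def)
    next
      case False
      then show ?thesis by (simp add: sum_nonneg B)
    qed
    then show "AE x in X. ?Z x \<le> (\<Sum>y\<in>?C - {0\<^sub>v N}. of_bool (y \<in> ?D x) * B y)"
      by (simp add: AE_measure_pmf_iff)
  qed
  also have "\<dots> = (\<Sum>y\<in>?C - {0\<^sub>v N}. measure_pmf.prob X {x. y \<in> ?D x} * B y)"
    by (subst Bochner_Integration.integral_sum[OF int_dual])
      (simp only: integral_mult_left_zero exp_dual)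
  also have "\<dots> \<le> (\<Sum>y\<in>?C - {0\<^sub>v N}. \<epsilon> * ?q powi (int m - int N) * B y)"
    by (intro sum_mono mult_right_mono prob B)
  \<comment> \<open>Adding back the nonnegative term of \<open>y = 0\<close> completes the sum to
    the one in Parseval's identity.\<close>
  also have "\<dots> \<le> \<epsilon> * ?q powi (int m - int N) * (\<Sum>y\<in>?C. B y)"
    unfolding sum_distrib_left[symmetric] using \<epsilon> by (intro mult_left_mono sum_mono2) (auto simp: B)
  also have "\<dots> = \<epsilon> * ?q ^ m * (\<Sum>a\<in>?C. (w a)\<^sup>2)"
    using q by (simp add: B_def sum_avg_char_quadratic power_int_diff)
  finally show ?thesis .
qed

section \<open>Excess collision probability\<close>

text \<open>If \<open>r\<close> is the marginal of \<open>w\<close> and \<open>M\<close> the size of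
  the range, this is the chi-square divergence of the hashed distribution from uniform times
  marginal. Keeping \<open>r\<close> separate lets \<open>w\<close> be a truncated distribution
  while the weight stays the full marginal. Terms with \<open>r e = 0\<close> are 0 by the
  convention for division.\<close>

definition collision_excess ::
    "'a set \<Rightarrow> 'e set \<Rightarrow> real \<Rightarrow> ('a \<Rightarrow> 'e \<Rightarrow> real) \<Rightarrow> ('e \<Rightarrow> real) \<Rightarrow> ('a \<Rightarrow> 'b) \<Rightarrow> real" where
  "collision_excess A E M w r f = (\<Sum>e\<in>E.
     (M * (\<Sum>a\<in>A. \<Sum>a'\<in>A. w a e * w a' e * of_bool (f a = f a')) - (\<Sum>a\<in>A. w a e)\<^sup>2) / r e)"

lemma sum_square_deviation_eq_collisions:
  fixes w :: "'a \<Rightarrow> real"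
  assumes "finite A" "finite B" "B \<noteq> {}" "f ` A \<subseteq> B"
  shows "real (card B) * (\<Sum>b\<in>B. ((\<Sum>a | a \<in> A \<and> f a = b. w a) - (\<Sum>a\<in>A. w a) / card B)\<^sup>2)
    = card B * (\<Sum>a\<in>A. \<Sum>a'\<in>A. w a * w a' * of_bool (f a = f a')) - (\<Sum>a\<in>A. w a)\<^sup>2"
proof -
  define M where "M = real (card B)"
  have M: "M > 0" using assms by (simp add: M_def card_gt_0_iff)
  define W where "W = (\<Sum>a\<in>A. w a)"
  define g where "g b = (\<Sum>a | a \<in> A \<and> f a = b. w a)" for b
  have gW: "(\<Sum>b\<in>B. g b) = W" unfolding g_def W_def using assms by (intro sum.group) auto
  have "(\<Sum>b\<in>B. (g b - W / M)\<^sup>2) = (\<Sum>b\<in>B. (g b)\<^sup>2 - 2 * (W / M) * g b + (W / M)\<^sup>2)"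
    by (intro sum.cong) (auto simp: power2_eq_square algebra_simps)
  also have "\<dots> = (\<Sum>b\<in>B. (g b)\<^sup>2) - 2 * (W / M) * W + M * (W / M)\<^sup>2"
    by (simp only: sum.distrib sum_subtractf gW sum_distrib_left[symmetric] sum_constant M_def)
  finally have "M * (\<Sum>b\<in>B. (g b - W / M)\<^sup>2) = M * (\<Sum>b\<in>B. (g b)\<^sup>2) - W\<^sup>2"
    using M by (simp add: power2_eq_square field_simps)
  then show ?thesis
    using sum_collision_eq_sum_squares[OF assms(1,2,4), of w] by (simp add: g_def W_def M_def)
qed

lemma collision_excess_nonneg:
  assumes "finite A" "finite B" "B \<noteq> {}" "f ` A \<subseteq> B" "\<And>e. e \<in> E \<Longrightarrow> 0 \<le> r e"
  shows "0 \<le> collision_excess A E (real (card B)) w r f"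
  unfolding collision_excess_def
  by (intro sum_nonneg divide_nonneg_nonneg assms)
    (subst sum_square_deviation_eq_collisions[OF assms(1-4), symmetric], simp add: sum_nonneg)

text \<open>Cauchy-Schwarz against the weights \<open>r e / M\<close>, whose total over
  \<open>B \<times> E\<close> is at most 1. Where \<open>r e = 0\<close> the quotient
  \<open>M / r e\<close> degenerates, but there the deviation is itself 0 because \<open>w\<close>
  vanishes.\<close>

lemma sum_deviation_le_sqrt_collision_excess:
  fixes w :: "'a \<Rightarrow> 'e \<Rightarrow> real"
  assumes fin: "finite A" "finite B" "finite E" "B \<noteq> {}" "f ` A \<subseteq> B"
    and r: "\<And>e. e \<in> E \<Longrightarrow> 0 \<le> r e" "(\<Sum>e\<in>E. r e) \<le> 1"
    and w: "\<And>a e. a \<in> A \<Longrightarrow> e \<in> E \<Longrightarrow> r e = 0 \<Longrightarrow> w a e = 0"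
  shows "(\<Sum>b\<in>B. \<Sum>e\<in>E. \<bar>(\<Sum>a | a \<in> A \<and> f a = b. w a e) - (\<Sum>a\<in>A. w a e) / card B\<bar>)
    \<le> sqrt (collision_excess A E (real (card B)) w r f)"
proof -
  define M where "M = real (card B)"
  have M: "M > 0" using fin by (simp add: M_def card_gt_0_iff)
  define x where "x b e = (\<Sum>a | a \<in> A \<and> f a = b. w a e) - (\<Sum>a\<in>A. w a e) / M" for b e
  have x0: "x b e = 0" if "e \<in> E" "r e = 0" for b e
    using w that by (simp add: x_def)
  have "(\<Sum>b\<in>B. \<Sum>e\<in>E. \<bar>x b e\<bar>) = (\<Sum>(b, e)\<in>B \<times> E. sqrt (r e / M) * (\<bar>x b e\<bar> * sqrt (M / r e)))"
    unfolding sum.cartesian_product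
  proof (rule sum.cong[OF refl], clarify)
    fix b e assume e: "e \<in> E"
    show "\<bar>x b e\<bar> = sqrt (r e / M) * (\<bar>x b e\<bar> * sqrt (M / r e))"
    proof (cases "r e = 0")
      case False
      then have "r e > 0" using r(1)[OF e] by simp
      then have "sqrt (r e / M) * sqrt (M / r e) = 1"
        using M by (simp flip: real_sqrt_mult)
      then show ?thesis by (simp add: mult.left_commute)
    qed (simp add: x0 e)
  qed
  then have "(\<Sum>b\<in>B. \<Sum>e\<in>E. \<bar>x b e\<bar>)\<^sup>2
      = (\<Sum>z\<in>B \<times> E. sqrt (r (snd z) / M) * (\<bar>x (fst z) (snd z)\<bar> * sqrt (M / r (snd z))))\<^sup>2"
    by (simp add: case_prod_unfold)
  also have "\<dots> \<le> (\<Sum>z\<in>B \<times> E. (sqrt (r (snd z) / M))\<^sup>2) * (\<Sum>z\<in>B \<times> E. (\<bar>x (fst z) (snd z)\<bar> * sqrt (M / r (snd z)))\<^sup>2)"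
    by (rule Cauchy_Schwarz_ineq_sum)
  also have "(\<Sum>z\<in>B \<times> E. (sqrt (r (snd z) / M))\<^sup>2) = (\<Sum>z\<in>B \<times> E. r (snd z) / M)"
    using M r by (intro sum.cong) (auto intro!: real_sqrt_pow2 divide_nonneg_pos)
  also have "\<dots> = (\<Sum>b\<in>B. \<Sum>e\<in>E. r e / M)"
    unfolding sum.cartesian_product case_prod_unfold ..
  also have "\<dots> = (\<Sum>e\<in>E. r e)" using M by (simp add: M_def flip: sum_divide_distrib)
  also have "(\<Sum>z\<in>B \<times> E. (\<bar>x (fst z) (snd z)\<bar> * sqrt (M / r (snd z)))\<^sup>2)
      = (\<Sum>z\<in>B \<times> E. M * (x (fst z) (snd z))\<^sup>2 / r (snd z))"
    using M r by (intro sum.cong) (auto simp: power_mult_distrib)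
  also have "\<dots> = (\<Sum>b\<in>B. \<Sum>e\<in>E. M * (x b e)\<^sup>2 / r e)"
    by (simp add: sum.cartesian_product case_prod_unfold)
  also have "\<dots> = (\<Sum>e\<in>E. M * (\<Sum>b\<in>B. (x b e)\<^sup>2) / r e)"
    by (subst sum.swap) (simp add: sum_distrib_left sum_divide_distrib)
  also have "\<dots> = collision_excess A E M w r f"
    unfolding x_def M_def collision_excess_def
    by (simp add: sum_square_deviation_eq_collisions[OF fin(1,2,4,5)])
  finally have "(\<Sum>b\<in>B. \<Sum>e\<in>E. \<bar>x b e\<bar>)\<^sup>2 \<le> (\<Sum>e\<in>E. r e) * collision_excess A E M w r f" .
  also have "\<dots> \<le> 1 * collision_excess A E M w r f"
    using collision_excess_nonneg[where w = w, OF fin(1,2,4,5) r(1)] r by (intro mult_right_mono) (auto simp: M_def)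
  finally have "(\<Sum>b\<in>B. \<Sum>e\<in>E. \<bar>x b e\<bar>)\<^sup>2 \<le> collision_excess A E M w r f" by simp
  then show ?thesis by (simp add: real_le_rsqrt x_def M_def)
qed

text \<open>The discarded mass \<open>p - w\<close> enters twice, once in the image distribution and
  once in the uniform distribution it is compared with; this gives the factor 2.\<close>

lemma sum_deviation_le:
  fixes p :: "'a \<Rightarrow> 'e \<Rightarrow> real"
  assumes fin: "finite A" "finite B" "finite E" "B \<noteq> {}" "f ` A \<subseteq> B"
    and r: "\<And>e. r e = (\<Sum>a\<in>A. p a e)" "(\<Sum>e\<in>E. r e) \<le> 1"
    and w: "\<And>a e. 0 \<le> w a e" "\<And>a e. w a e \<le> p a e"
  shows "(\<Sum>b\<in>B. \<Sum>e\<in>E. \<bar>(\<Sum>a | a \<in> A \<and> f a = b. p a e) - r e / card B\<bar>)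
    \<le> 2 * (\<Sum>a\<in>A. \<Sum>e\<in>E. p a e - w a e) + sqrt (collision_excess A E (real (card B)) w r f)"
proof -
  define M where "M = real (card B)"
  have M: "M > 0" using fin by (simp add: M_def card_gt_0_iff)
  have p: "0 \<le> p a e" for a e using w order_trans by blast
  have r0: "0 \<le> r e" for e by (simp add: r p sum_nonneg)
  have w0: "w a e = 0" if "a \<in> A" "r e = 0" for a e
    using that p w fin(1) by (metis antisym r(1) sum_nonneg_eq_0_iff)
  define d where "d a e = p a e - w a e" for a e
  have d: "0 \<le> d a e" for a e using w by (simp add: d_def)
  let ?g = "\<lambda>u b e. \<Sum>a | a \<in> A \<and> f a = b. u a e"
  let ?x = "\<lambda>b e. \<bar>?g w b e - (\<Sum>a\<in>A. w a e) / M\<bar>"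
  have "(\<Sum>b\<in>B. \<Sum>e\<in>E. \<bar>?g p b e - r e / M\<bar>)
      \<le> (\<Sum>b\<in>B. \<Sum>e\<in>E. ?x b e + (?g d b e + (\<Sum>a\<in>A. d a e) / M))"
  proof (intro sum_mono)
    fix b e
    have "?g p b e - r e / M = (?g w b e - (\<Sum>a\<in>A. w a e) / M) + (?g d b e - (\<Sum>a\<in>A. d a e) / M)"
      by (simp add: d_def r sum_subtractf diff_divide_distrib)
    moreover have "0 \<le> ?g d b e" "0 \<le> (\<Sum>a\<in>A. d a e) / M" using M d by (auto intro!: sum_nonneg divide_nonneg_pos)
    ultimately show "\<bar>?g p b e - r e / M\<bar> \<le> ?x b e + (?g d b e + (\<Sum>a\<in>A. d a e) / M)" by linarith
  qed
  also have "\<dots> = (\<Sum>b\<in>B. \<Sum>e\<in>E. ?x b e) + ((\<Sum>b\<in>B. \<Sum>e\<in>E. ?g d b e) + (\<Sum>e\<in>E. \<Sum>a\<in>A. d a e))"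
    using M by (simp add: sum.distrib M_def flip: sum_divide_distrib)
  also have "(\<Sum>b\<in>B. \<Sum>e\<in>E. ?g d b e) = (\<Sum>e\<in>E. \<Sum>a\<in>A. d a e)"
    using fin by (subst sum.swap) (simp add: sum.group)
  also have "(\<Sum>e\<in>E. \<Sum>a\<in>A. d a e) = (\<Sum>a\<in>A. \<Sum>e\<in>E. d a e)" by (rule sum.swap)
  finally show ?thesis
    using sum_deviation_le_sqrt_collision_excess[OF fin r0 r(2), of w] w0 by (simp add: d_def M_def)
qed

text \<open>The points above the threshold number at most \<open>card B / c\<close> when the total
  mass is positive, so the uniform distribution gives their image at most a fraction
  \<open>1 / c\<close> of that mass, while the actual image distribution retains all the mass of
  these points.\<close>

lemma sum_deviation_ge:
  fixes p :: "'a \<Rightarrow> real"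
  assumes fin: "finite A" "finite B" "B \<noteq> {}" "f ` A \<subseteq> B"
    and p: "\<And>a. 0 \<le> p a" and c: "c > 0"
  shows "2 * ((\<Sum>a | a \<in> A \<and> p a > c / card B * (\<Sum>a\<in>A. p a). p a) - (\<Sum>a\<in>A. p a) / c)
    \<le> (\<Sum>b\<in>B. \<bar>(\<Sum>a | a \<in> A \<and> f a = b. p a) - (\<Sum>a\<in>A. p a) / card B\<bar>)"
proof -
  define M where "M = real (card B)"
  have M: "M > 0" using fin by (simp add: M_def card_gt_0_iff)
  define r where "r = (\<Sum>a\<in>A. p a)"
  have r: "0 \<le> r" by (simp add: r_def sum_nonneg p)
  define S where "S = {a \<in> A. p a > c / M * r}"
  have S: "finite S" "S \<subseteq> A" using fin by (auto simp: S_def)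
  have card: "real (card (f ` S)) * r / M \<le> r / c"
  proof -
    have "real (card S) * (c / M * r) \<le> (\<Sum>a\<in>S. p a)"
      using sum_mono[of S "\<lambda>_. c / M * r" p] by (simp add: S_def)
    also have "\<dots> \<le> r" unfolding r_def using S fin p by (intro sum_mono2) auto
    finally have "real (card S) * r / M \<le> r / c" using c M by (simp add: field_simps)
    moreover have "real (card (f ` S)) * r / M \<le> real (card S) * r / M"
      using card_image_le[OF S(1), of f] r M by (intro divide_right_mono mult_right_mono) auto
    ultimately show ?thesis by simp
  qed
  define x where "x b = (\<Sum>a | a \<in> A \<and> f a = b. p a) - r / M" for b
  have x: "(\<Sum>b\<in>B. x b) = 0"
    using fin M by (simp add: x_def sum_subtractf sum.group) (simp add: r_def M_def)
  have fS: "f ` S \<subseteq> B" "finite (f ` S)" using fin S by auto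
  have "(\<Sum>a\<in>S. p a) - r / c \<le> (\<Sum>a | a \<in> A \<and> f a \<in> f ` S. p a) - real (card (f ` S)) * r / M"
  proof -
    have "(\<Sum>a\<in>S. p a) \<le> (\<Sum>a | a \<in> A \<and> f a \<in> f ` S. p a)"
      using S fin p by (intro sum_mono2) auto
    then show ?thesis using card by linarith
  qed
  also have "(\<Sum>a | a \<in> A \<and> f a \<in> f ` S. p a) = (\<Sum>b\<in>f ` S. \<Sum>a | a \<in> {a. a \<in> A \<and> f a \<in> f ` S} \<and> f a = b. p a)"
    using fin S by (intro sum.group[symmetric]) auto
  also have "\<dots> = (\<Sum>b\<in>f ` S. \<Sum>a | a \<in> A \<and> f a = b. p a)"
    by (intro sum.cong refl) auto
  also have "\<dots> - real (card (f ` S)) * r / M = (\<Sum>b\<in>f ` S. x b)"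
    by (simp add: x_def sum_subtractf)
  finally have 1: "(\<Sum>a\<in>S. p a) - r / c \<le> (\<Sum>b\<in>f ` S. x b)" .
  \<comment> \<open>All deviations together sum to zero, so an excess on the image of
    \<open>S\<close> is matched by an equal deficit outside it.\<close>
  have "2 * (\<Sum>b\<in>f ` S. x b) = (\<Sum>b\<in>f ` S. x b) - (\<Sum>b\<in>B - f ` S. x b)"
    using x fS fin by (simp add: sum_diff)
  also have "\<dots> \<le> (\<Sum>b\<in>f ` S. \<bar>x b\<bar>) + (\<Sum>b\<in>B - f ` S. \<bar>x b\<bar>)"
    unfolding diff_conv_add_uminus sum_negf[symmetric] by (intro add_mono sum_mono) auto
  also have "\<dots> = (\<Sum>b\<in>B. \<bar>x b\<bar>)"
    using fS fin by (metis add.commute sum.subset_diff)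
  finally show ?thesis using 1 by (simp add: S_def x_def r_def M_def)
qed

text \<open>The right-hand side is the mean of the left-hand side over a uniformly random map, under
  which distinct points collide with probability \<open>1 / card B\<close>. The induction attains it
  greedily, sending each new point to a value with at most average load. Because \<open>K\<close> is
  an arbitrary kernel, it can already be summed over the side information.\<close>

lemma ex_map_few_collisions:
  fixes K :: "'a \<Rightarrow> 'a \<Rightarrow> real"
  assumes "finite A" "finite B" "B \<noteq> {}"
  shows "\<exists>f\<in>A \<rightarrow> B. card B * (\<Sum>a\<in>A. \<Sum>a'\<in>A. K a a' * of_bool (f a = f a'))
     \<le> (real (card B) - 1) * (\<Sum>a\<in>A. K a a) + (\<Sum>a\<in>A. \<Sum>a'\<in>A. K a a')"
  using assms(1)
proof induction
  case empty
  then show ?case by simp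
next
  case (insert x F)
  define M where "M = real (card B)"
  have M: "M > 0" using assms by (simp add: M_def card_gt_0_iff)
  from insert obtain f where f: "f \<in> F \<rightarrow> B"
    "M * (\<Sum>a\<in>F. \<Sum>a'\<in>F. K a a' * of_bool (f a = f a')) \<le> (M - 1) * (\<Sum>a\<in>F. K a a) + (\<Sum>a\<in>F. \<Sum>a'\<in>F. K a a')"
    by (auto simp: M_def)
  \<comment> \<open>Both orders of each pair are collected, as \<open>K\<close> need not be
    symmetric.\<close>
  define L where "L a = K a x + K x a" for a
  define T where "T = (\<Sum>a\<in>F. L a)"
  \<comment> \<open>Averaging: the fibres of \<open>f\<close> partition \<open>F\<close>, so the
    loads of the values in \<open>B\<close> add up to \<open>T\<close>, and not all of them can
    exceed \<open>T / M\<close>.\<close>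
  have "\<exists>b\<in>B. M * (\<Sum>a | a \<in> F \<and> f a = b. L a) \<le> T"
  proof (rule ccontr)
    assume "\<not> ?thesis"
    then have "(\<Sum>b\<in>B. T) < (\<Sum>b\<in>B. M * (\<Sum>a | a \<in> F \<and> f a = b. L a))"
      using assms by (intro sum_strict_mono) auto
    also have "\<dots> = M * T"
      using f assms insert by (simp add: T_def sum.group Pi_iff image_subset_iff flip: sum_distrib_left)
    finally show False by (simp add: M_def)
  qed
  then obtain b where b: "b \<in> B" "M * (\<Sum>a | a \<in> F \<and> f a = b. L a) \<le> T" by blast
  let ?g = "f(x := b)"
  have Lb: "(\<Sum>a | a \<in> F \<and> f a = b. L a) = (\<Sum>a\<in>F. K a x * of_bool (f a = b)) + (\<Sum>a\<in>F. K x a * of_bool (b = f a))"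
    unfolding sum.distrib[symmetric] using insert
    by (intro sum.mono_neutral_cong_left) (auto simp: L_def)
  have gF: "?g a = f a" if "a \<in> F" for a using that insert by auto
  have "(\<Sum>a\<in>insert x F. \<Sum>a'\<in>insert x F. K a a' * of_bool (?g a = ?g a'))
      = K x x + (\<Sum>a\<in>F. K x a * of_bool (b = f a)) + ((\<Sum>a\<in>F. K a x * of_bool (f a = b))
        + (\<Sum>a\<in>F. \<Sum>a'\<in>F. K a a' * of_bool (f a = f a')))"
    using insert by (simp add: sum.distrib gF del: sum_mult_of_bool_eq sum_of_bool_mult_eq fun_upd_apply cong: sum.cong) simp
  also have "\<dots> = K x x + (\<Sum>a | a \<in> F \<and> f a = b. L a) + (\<Sum>a\<in>F. \<Sum>a'\<in>F. K a a' * of_bool (f a = f a'))"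
    unfolding Lb by linarith
  finally have "M * (\<Sum>a\<in>insert x F. \<Sum>a'\<in>insert x F. K a a' * of_bool (?g a = ?g a'))
      \<le> M * K x x + T + ((M - 1) * (\<Sum>a\<in>F. K a a) + (\<Sum>a\<in>F. \<Sum>a'\<in>F. K a a'))"
    using b f by (simp add: distrib_left)
  also have "\<dots> = (M - 1) * (\<Sum>a\<in>insert x F. K a a) + (\<Sum>a\<in>insert x F. \<Sum>a'\<in>insert x F. K a a')"
    using insert by (simp add: T_def L_def sum.distrib algebra_simps)
  finally show ?case using b f by (intro bexI[of _ ?g]) (auto simp: M_def)
qed

section \<open>Central limit theorem for i.i.d. lists\<close>

lemma prob_space_PiM_pmf: "prob_space (\<Pi>\<^sub>M i\<in>(UNIV :: nat set). measure_pmf p)"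
  by (intro prob_space_PiM measure_pmf.prob_space_axioms)

text \<open>The central limit theorem asks for one space carrying an infinite independent sequence,
  whereas \<open>replicate_pmf n p\<close> changes with \<open>n\<close>. The infinite product
  supplies that space.\<close>

lemma indep_vars_PiM_pmf:
  fixes g :: "'a \<Rightarrow> real" and p :: "'a pmf"
  defines "M \<equiv> \<Pi>\<^sub>M i\<in>(UNIV :: nat set). measure_pmf p"
  shows "prob_space.indep_vars M (\<lambda>_. borel) (\<lambda>i \<omega>. g (\<omega> i)) UNIV"
    and "distr M (measure_pmf p) (\<lambda>\<omega>. \<omega> i) = measure_pmf p"
proof -
  interpret prob_space M unfolding M_def by (rule prob_space_PiM_pmf)
  show comp: "distr M (measure_pmf p) (\<lambda>\<omega>. \<omega> i) = measure_pmf p" for i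
  proof -
    interpret product_prob_space "\<lambda>_. measure_pmf p" "UNIV :: nat set" by standard
    show ?thesis unfolding M_def by (rule PiM_component) simp
  qed
  have rv: "random_variable (measure_pmf p) (\<lambda>\<omega>. \<omega> i)" for i
    unfolding M_def by (rule measurable_component_singleton) simp
  have "distr M (\<Pi>\<^sub>M i\<in>UNIV. measure_pmf p) (\<lambda>\<omega>. \<lambda>i\<in>UNIV. \<omega> i)
      = (\<Pi>\<^sub>M i\<in>UNIV. distr M (measure_pmf p) (\<lambda>\<omega>. \<omega> i))"
    unfolding comp by (simp add: restrict_UNIV M_def)
  then have "indep_vars (\<lambda>_. measure_pmf p) (\<lambda>i \<omega>. \<omega> i) UNIV"
    using indep_vars_iff_distr_eq_PiM[where M' = "\<lambda>_. measure_pmf p" and X = "\<lambda>i \<omega>. \<omega> i", OF UNIV_not_empty rv]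
    by simp
  then show "indep_vars (\<lambda>_. borel) (\<lambda>i \<omega>. g (\<omega> i)) UNIV"
    by (rule indep_vars_compose2) simp
qed

lemma pmf_pair_fst_snd: "pmf (pair_pmf p q) z = pmf p (fst z) * pmf q (snd z)"
  by (cases z) (simp add: pmf_pair)

text \<open>A list of length \<open>Suc n\<close> is a head with an independent tail, so the
  characteristic function picks up one factor. With finite support the expectations are finite sums,
  and the factorisation is distributivity.\<close>

lemma char_sum_list_replicate_pmf:
  fixes g :: "'a \<Rightarrow> real"
  assumes fin: "finite (set_pmf p)"
  shows "char (distr (measure_pmf (replicate_pmf n p)) borel (\<lambda>xs. \<Sum>x\<leftarrow>xs. g x)) t
    = (char (distr (measure_pmf p) borel g) t) ^ n"
proof (induction n)
  case 0
  show ?case by (simp add: char_def integral_distr)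
next
  case (Suc n)
  have int: "integrable (measure_pmf q) (\<lambda>x. iexp (t * h x))" for q :: "'b pmf" and h :: "'b \<Rightarrow> real"
    by (rule measure_pmf.integrable_const_bound[where B = 1]) auto
  have char: "char (distr (measure_pmf q) borel h) t = measure_pmf.expectation q (\<lambda>x. iexp (t * h x))"
    for q :: "'b pmf" and h :: "'b \<Rightarrow> real"
    by (simp add: char_def integral_distr)
  have *: "replicate_pmf (Suc n) p = map_pmf (\<lambda>(x, xs). x # xs) (pair_pmf p (replicate_pmf n p))"
    by (simp add: pair_pmf_def map_bind_pmf)
  have "measure_pmf.expectation (replicate_pmf (Suc n) p) (\<lambda>xs. iexp (t * (\<Sum>x\<leftarrow>xs. g x)))
      = measure_pmf.expectation (pair_pmf p (replicate_pmf n p)) (\<lambda>z. iexp (t * g (fst z)) * iexp (t * (\<Sum>x\<leftarrow>snd z. g x)))"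
    by (simp add: * case_prod_unfold ring_distribs exp_add del: replicate_pmf.simps)
  also have "\<dots> = measure_pmf.expectation p (\<lambda>x. iexp (t * g x))
      * measure_pmf.expectation (replicate_pmf n p) (\<lambda>xs. iexp (t * (\<Sum>x\<leftarrow>xs. g x)))"
  proof -
    have fin': "finite (set_pmf (replicate_pmf n p))"
      using finite_lists_length_eq[OF fin, of n] by (simp add: set_replicate_pmf lists_eq_set conj_commute)
    have 1: "measure_pmf.expectation (pair_pmf p (replicate_pmf n p)) h
        = (\<Sum>z\<in>set_pmf p \<times> set_pmf (replicate_pmf n p). pmf (pair_pmf p (replicate_pmf n p)) z *\<^sub>R h z)"
      for h :: "_ \<Rightarrow> complex"
      by (rule integral_measure_pmf) (use fin fin' in auto)
    have 2: "measure_pmf.expectation q h = (\<Sum>z\<in>set_pmf q. pmf q z *\<^sub>R h z)"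
      if "finite (set_pmf q)" for q :: "'b pmf" and h :: "'b \<Rightarrow> complex"
      by (rule integral_measure_pmf) (use that in auto)
    show ?thesis
      unfolding 1 2[OF fin] 2[OF fin'] sum_product sum.cartesian_product
      by (intro sum.cong refl) (simp add: case_prod_unfold pmf_pair_fst_snd scaleR_conv_of_real mult_ac)
  qed
  finally show ?case using Suc by (simp add: char del: replicate_pmf.simps)
qed

text \<open>The two sums live on different spaces, but both have the \<open>n\<close>-th power of
  the same characteristic function; Levy's uniqueness theorem identifies their laws, so limits
  transfer from sequences to lists.\<close>

lemma distr_sum_PiM_pmf:
  fixes g :: "'a \<Rightarrow> real"
  assumes fin: "finite (set_pmf p)"
  shows "distr (\<Pi>\<^sub>M i\<in>(UNIV :: nat set). measure_pmf p) borel (\<lambda>\<omega>. \<Sum>i<n. g (\<omega> i))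
    = distr (measure_pmf (replicate_pmf n p)) borel (\<lambda>xs. \<Sum>x\<leftarrow>xs. g x)"
proof -
  let ?M = "\<Pi>\<^sub>M i\<in>(UNIV :: nat set). measure_pmf p"
  interpret prob_space ?M by (rule prob_space_PiM_pmf)
  have indep: "indep_vars (\<lambda>_. borel) (\<lambda>i \<omega>. g (\<omega> i)) {..<n}"
    using indep_vars_subset[OF indep_vars_PiM_pmf(1)] by blast
  have meas [measurable]: "(\<lambda>\<omega>. g (\<omega> i)) \<in> borel_measurable ?M" for i
    using measurable_compose[OF measurable_component_singleton[of i UNIV "\<lambda>_. measure_pmf p"], of g borel] by simp
  have "distr ?M borel (\<lambda>\<omega>. g (\<omega> i)) = distr (measure_pmf p) borel g" for i
    using distr_distr[of g "measure_pmf p" borel "\<lambda>\<omega>. \<omega> i" ?M] indep_vars_PiM_pmf(2)[of p i]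
    by (simp add: o_def measurable_component_singleton)
  then have "char (distr ?M borel (\<lambda>\<omega>. \<Sum>i<n. g (\<omega> i))) t = char (distr (measure_pmf p) borel g) t ^ n" for t
    using char_distr_sum[OF indep] by simp
  then have "char (distr ?M borel (\<lambda>\<omega>. \<Sum>i<n. g (\<omega> i)))
      = char (distr (measure_pmf (replicate_pmf n p)) borel (\<lambda>xs. \<Sum>x\<leftarrow>xs. g x))"
    by (simp add: fun_eq_iff char_sum_list_replicate_pmf[OF fin])
  moreover have "real_distribution (distr ?M borel (\<lambda>\<omega>. \<Sum>i<n. g (\<omega> i)))"
    by (rule real_distribution_distr) measurable
  moreover have "real_distribution (distr (measure_pmf (replicate_pmf n p)) borel (\<lambda>xs. \<Sum>x\<leftarrow>xs. g x))"
    by (rule prob_space.real_distribution_distr[OF measure_pmf.prob_space_axioms]) simp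
  ultimately show ?thesis by (intro Levy_uniqueness)
qed

lemma central_limit_replicate_pmf:
  fixes g :: "'a \<Rightarrow> real" and \<mu> v :: real
  assumes fin: "finite (set_pmf p)"
    and mean: "measure_pmf.expectation p g = \<mu>"
    and var: "measure_pmf.expectation p (\<lambda>x. (g x - \<mu>)\<^sup>2) = v" and v: "v > 0"
  shows "weak_conv_m (\<lambda>n. distr (measure_pmf (replicate_pmf n p)) borel (\<lambda>xs. ((\<Sum>x\<leftarrow>xs. g x) - n * \<mu>) / sqrt (n * v)))
    std_normal_distribution"
proof -
  let ?M = "\<Pi>\<^sub>M i\<in>(UNIV :: nat set). measure_pmf p"
  interpret prob_space ?M by (rule prob_space_PiM_pmf)
  note comp = indep_vars_PiM_pmf(2)[of p]
  have meas [measurable]: "(\<lambda>\<omega>. h (\<omega> i)) \<in> borel_measurable ?M" for h :: "'a \<Rightarrow> real" and i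
    using measurable_compose[OF measurable_component_singleton[of i UNIV "\<lambda>_. measure_pmf p"], of h borel] by simp
  define X where "X i \<omega> = g (\<omega> i)" for i :: nat and \<omega>
  have int: "integrable (measure_pmf p) h" for h :: "'a \<Rightarrow> real"
    using fin by (rule integrable_measure_pmf_finite)
  have exp: "expectation (\<lambda>\<omega>. h (\<omega> i)) = measure_pmf.expectation p h" for h :: "'a \<Rightarrow> real" and i
    using integral_distr[of "\<lambda>\<omega>. \<omega> i" ?M "measure_pmf p" h] by (simp add: comp measurable_component_singleton)
  have int': "integrable ?M (\<lambda>\<omega>. h (\<omega> i))" for h :: "'a \<Rightarrow> real" and i
    using integrable_distr[of "\<lambda>\<omega>. \<omega> i" ?M "measure_pmf p" h] int[of h] by (simp add: comp measurable_component_singleton)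
  have indep: "indep_vars (\<lambda>_. borel) X UNIV"
    unfolding X_def[abs_def] by (rule indep_vars_PiM_pmf)
  have "weak_conv_m (\<lambda>n. distr ?M borel (\<lambda>\<omega>. (\<Sum>i<n. X i \<omega> - \<mu>) / sqrt (n * (sqrt v)\<^sup>2))) std_normal_distribution"
  proof (rule central_limit_theorem[where \<mu> = "distr (measure_pmf p) borel g"])
    show "expectation (X n) = \<mu>" for n using exp[of g n] mean by (simp add: X_def[abs_def])
    show "integrable ?M (\<lambda>x. (X n x)\<^sup>2)" for n using int'[of "\<lambda>x. (g x)\<^sup>2" n] by (simp add: X_def)
    show "variance (X n) = (sqrt v)\<^sup>2" for n
      using exp[of g n] mean exp[of "\<lambda>x. (g x - \<mu>)\<^sup>2" n] var v by (simp add: X_def[abs_def])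
    show "distr ?M borel (X n) = distr (measure_pmf p) borel g" for n
      using distr_distr[of g "measure_pmf p" borel "\<lambda>\<omega>. \<omega> n" ?M] by (simp add: comp X_def[abs_def] o_def measurable_component_singleton)
  qed (use v indep in auto)
  moreover have "distr ?M borel (\<lambda>\<omega>. (\<Sum>i<n. X i \<omega> - \<mu>) / sqrt (n * (sqrt v)\<^sup>2))
     = distr (measure_pmf (replicate_pmf n p)) borel (\<lambda>xs. ((\<Sum>x\<leftarrow>xs. g x) - n * \<mu>) / sqrt (n * v))" for n
  proof -
    have "distr ?M borel (\<lambda>\<omega>. (\<Sum>i<n. X i \<omega> - \<mu>) / sqrt (n * (sqrt v)\<^sup>2))
        = distr (distr ?M borel (\<lambda>\<omega>. \<Sum>i<n. g (\<omega> i))) borel (\<lambda>s. (s - n * \<mu>) / sqrt (n * v))"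
      using v by (subst distr_distr) (auto simp: o_def X_def sum_subtractf)
    also have "\<dots> = distr (measure_pmf (replicate_pmf n p)) borel (\<lambda>xs. ((\<Sum>x\<leftarrow>xs. g x) - n * \<mu>) / sqrt (n * v))"
      unfolding distr_sum_PiM_pmf[OF fin] by (subst distr_distr) (auto simp: o_def)
    finally show ?thesis .
  qed
  ultimately show ?thesis by simp
qed

text \<open>Weak convergence speaks about fixed thresholds and non-strict inequalities, whereas here
  the threshold moves with \<open>n\<close> and the inequality is strict. Fixed thresholds just left
  and right of the limit enclose the moving one, and continuity of the normal distribution function
  closes the gap.\<close>

lemma prob_sum_list_less_tendsto:
  fixes g :: "'a \<Rightarrow> real" and t :: "nat \<Rightarrow> real" and \<mu> v R :: real
  assumes fin: "finite (set_pmf p)"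
    and mean: "measure_pmf.expectation p g = \<mu>"
    and var: "measure_pmf.expectation p (\<lambda>x. (g x - \<mu>)\<^sup>2) = v" and v: "v > 0"
    and t: "(\<lambda>n. (t n - n * \<mu>) / sqrt n) \<longlonglongrightarrow> R"
  shows "(\<lambda>n. measure_pmf.prob (replicate_pmf n p) {xs. (\<Sum>x\<leftarrow>xs. g x) < t n})
    \<longlonglongrightarrow> (LBINT x:{..R / sqrt v}. 1 / sqrt (2 * pi) * exp (- x\<^sup>2 / 2))"
proof -
  let ?N = std_normal_distribution
  let ?q = "\<lambda>n. replicate_pmf n p"
  interpret N: real_distribution ?N by (rule real_dist_normal_dist)
  define S where "S = (\<lambda>(n :: nat) xs. ((\<Sum>x\<leftarrow>xs. g x) - n * \<mu>) / sqrt (n * v))"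
  have cont: "isCont (cdf ?N) x" for x
  proof -
    have "emeasure ?N {x} = 0"
      by (subst emeasure_density) (auto simp: nn_integral_null_delta intro!: nn_integral_0_iff_AE[THEN iffD2] AE_mp[OF AE_lborel_singleton[of x]])
    then show ?thesis by (simp add: N.isCont_cdf measure_def)
  qed
  have cdf: "cdf ?N x = (LBINT y:{..x}. 1 / sqrt (2 * pi) * exp (- y\<^sup>2 / 2))" for x
  proof -
    have "cdf ?N x = measure ?N {..x}" by (simp add: cdf_def)
    also have "\<dots> = (LINT y|?N. indicator {..x} y)" by simp
    also have "\<dots> = (LINT y|lborel. std_normal_density y *\<^sub>R indicator {..x} y)"
      by (rule integral_density) auto
    finally show ?thesis
      by (simp add: set_lebesgue_integral_def std_normal_density_def mult.commute)
  qed
  have conv: "(\<lambda>n. measure_pmf.prob (?q n) {xs. S n xs \<le> x}) \<longlonglongrightarrow> cdf ?N x" for x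
  proof -
    have "cdf (distr (measure_pmf (?q n)) borel (S n)) x = measure_pmf.prob (?q n) {xs. S n xs \<le> x}" for n
      by (simp add: cdf_def measure_distr vimage_def)
    moreover have "(\<lambda>n. cdf (distr (measure_pmf (?q n)) borel (S n)) x) \<longlonglongrightarrow> cdf ?N x"
      using central_limit_replicate_pmf[OF fin mean var v] cont[of x]
      unfolding weak_conv_m_def weak_conv_def S_def by blast
    ultimately show ?thesis by simp
  qed
  define r where "r = R / sqrt v"
  define u where "u n = (t n - n * \<mu>) / sqrt (n * v)" for n
  have u: "u \<longlonglongrightarrow> r"
    using tendsto_divide[OF t tendsto_const[of "sqrt v"]] v by (simp add: u_def[abs_def] r_def real_sqrt_mult)
  \<comment> \<open>For \<open>n = 0\<close> the normalising divisor is 0 and the two events may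
    differ.\<close>
  have eq: "measure_pmf.prob (?q n) {xs. (\<Sum>x\<leftarrow>xs. g x) < t n} = measure_pmf.prob (?q n) {xs. S n xs < u n}"
    if "n \<ge> 1" for n
  proof -
    have "sqrt (n * v) > 0" using that v by simp
    then have "S n xs < u n \<longleftrightarrow> (\<Sum>x\<leftarrow>xs. g x) < t n" for xs
      unfolding S_def u_def by (subst divide_less_cancel) linarith
    then show ?thesis by simp
  qed
  have "(\<lambda>n. measure_pmf.prob (?q n) {xs. S n xs < u n}) \<longlonglongrightarrow> cdf ?N r"
  proof (rule order_tendstoI)
    fix a assume "a < cdf ?N r"
    then have "eventually (\<lambda>x. a < cdf ?N x) (at_left r)"
      using cont[of r] by (intro order_tendstoD) (auto simp: isCont_def intro: tendsto_within_subset)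
    then obtain x where x: "x < r" "a < cdf ?N x"
      unfolding eventually_at_left_field using dense by blast
    have "eventually (\<lambda>n. a < measure_pmf.prob (?q n) {xs. S n xs \<le> x} \<and> x < u n) sequentially"
      using order_tendstoD(1)[OF conv x(2)] order_tendstoD(1)[OF u x(1)] by (rule eventually_conj)
    then show "eventually (\<lambda>n. a < measure_pmf.prob (?q n) {xs. S n xs < u n}) sequentially"
    proof eventually_elim
      case (elim n)
      then have "measure_pmf.prob (?q n) {xs. S n xs \<le> x} \<le> measure_pmf.prob (?q n) {xs. S n xs < u n}"
        by (intro measure_pmf.finite_measure_mono) auto
      then show ?case using elim by simp
    qed
  next
    fix a assume "cdf ?N r < a"
    then have "eventually (\<lambda>x. cdf ?N x < a) (at_right r)"
      using cont[of r] by (intro order_tendstoD) (auto simp: isCont_def intro: tendsto_within_subset)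
    then obtain x where x: "r < x" "cdf ?N x < a"
      unfolding eventually_at_right_field using dense by blast
    have "eventually (\<lambda>n. measure_pmf.prob (?q n) {xs. S n xs \<le> x} < a \<and> u n < x) sequentially"
      using order_tendstoD(2)[OF conv x(2)] order_tendstoD(2)[OF u x(1)] by (rule eventually_conj)
    then show "eventually (\<lambda>n. measure_pmf.prob (?q n) {xs. S n xs < u n} < a) sequentially"
    proof eventually_elim
      case (elim n)
      then have "measure_pmf.prob (?q n) {xs. S n xs < u n} \<le> measure_pmf.prob (?q n) {xs. S n xs \<le> x}"
        by (intro measure_pmf.finite_measure_mono) auto
      then show ?case using elim by simp
    qed
  qed
  then have "(\<lambda>n. measure_pmf.prob (?q n) {xs. (\<Sum>x\<leftarrow>xs. g x) < t n}) \<longlonglongrightarrow> cdf ?N r"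
    by (rule Lim_transform_eventually) (use eq in \<open>auto simp: eventually_sequentially intro!: exI[of _ 1]\<close>)
  then show ?thesis by (simp add: cdf r_def)
qed

section \<open>Bounds on the security criterion\<close>

lemma measure_pmf_eq_sum:
  assumes "finite T" "S \<inter> set_pmf Q \<subseteq> T" "T \<subseteq> S"
  shows "measure_pmf.prob Q S = (\<Sum>z\<in>T. pmf Q z)"
proof -
  have "measure_pmf.prob Q S = measure_pmf.prob Q T"
    using assms by (intro measure_prob_cong_0) (auto simp: set_pmf_iff)
  then show ?thesis using assms by (simp add: measure_measure_pmf_finite)
qed

lemma d1'_nonneg: "0 \<le> d1' B E f Q"
  by (simp add: d1'_def sum_nonneg)

text \<open>The condition that the conditional probability exceeds \<open>c\<close>, cleared of its
  denominator, so that points with marginal 0 are not heavy. The argument \<open>c\<close> plays the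
  role of the quotient \<open>c / M\<close> of the overview.\<close>

definition heavy :: "('a \<times> 'e) pmf \<Rightarrow> real \<Rightarrow> ('a \<times> 'e) set" where
  "heavy Q c = {z. c * pmf (map_pmf snd Q) (snd z) < pmf Q z}"

definition light_part :: "('a \<times> 'e) pmf \<Rightarrow> real \<Rightarrow> 'a \<Rightarrow> 'e \<Rightarrow> real" where
  "light_part Q c a e = (if (a, e) \<in> heavy Q c then 0 else pmf Q (a, e))"

lemma light_part_nonneg: "0 \<le> light_part Q c a e"
  by (simp add: light_part_def)

context
  fixes Q :: "('a \<times> 'e) pmf" and A :: "'a set" and E :: "'e set"
  assumes fin: "finite A" "finite E" and space: "set_pmf Q \<subseteq> A \<times> E"
begin

lemma pmf_map_snd: "pmf (map_pmf snd Q) e = (\<Sum>a\<in>A. pmf Q (a, e))"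
proof -
  have "pmf (map_pmf snd Q) e = (\<Sum>z\<in>(\<lambda>a. (a, e)) ` A. pmf Q z)"
    unfolding pmf_map using fin space by (intro measure_pmf_eq_sum) auto
  then show ?thesis by (simp add: sum.reindex inj_on_def)
qed

lemma pmf_map_prod_id:
  "pmf (map_pmf (map_prod f id) Q) (b, e) = (\<Sum>a | a \<in> A \<and> f a = b. pmf Q (a, e))"
proof -
  have "pmf (map_pmf (map_prod f id) Q) (b, e) = (\<Sum>z\<in>(\<lambda>a. (a, e)) ` {a \<in> A. f a = b}. pmf Q z)"
    unfolding pmf_map using fin space by (intro measure_pmf_eq_sum) auto
  then show ?thesis by (simp add: sum.reindex inj_on_def)
qed

lemma sum_pmf_map_snd: "(\<Sum>e\<in>E. pmf (map_pmf snd Q) e) = 1"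
  using fin space by (intro sum_pmf_eq_1) auto

lemma prob_heavy:
  "measure_pmf.prob Q (heavy Q c) = (\<Sum>a\<in>A. \<Sum>e\<in>E. if (a, e) \<in> heavy Q c then pmf Q (a, e) else 0)"
proof -
  have "measure_pmf.prob Q (heavy Q c) = (\<Sum>z\<in>{z \<in> A \<times> E. z \<in> heavy Q c}. pmf Q z)"
    using fin space by (intro measure_pmf_eq_sum) auto
  also have "\<dots> = (\<Sum>z\<in>A \<times> E. if z \<in> heavy Q c then pmf Q z else 0)"
    using fin by (intro sum.inter_filter) auto
  finally show ?thesis unfolding sum.cartesian_product case_prod_unfold prod.collapse .
qed

lemma d1'_alt:
  "d1' B E f Q = (\<Sum>b\<in>B. \<Sum>e\<in>E. \<bar>(\<Sum>a | a \<in> A \<and> f a = b. pmf Q (a, e))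
     - pmf (map_pmf snd Q) e / card B\<bar>)"
  by (simp add: d1'_def pmf_map_prod_id)

text \<open>Cutting a map down to \<open>A\<close> places it in the finite set
  \<open>A \<rightarrow>\<^sub>E B\<close> over which the minimum is taken.\<close>

lemma d1'_restrict: "d1' B E (restrict f A) Q = d1' B E f Q"
  unfolding d1'_alt by (intro sum.cong refl arg_cong[where f = abs] arg_cong2[where f = "(-)"]) auto

text \<open>The bound for a single distribution is applied to each slice of fixed \<open>e\<close>:
  its threshold, proportional to the mass of the slice, is exactly the one defining
  \<open>heavy\<close>. The losses add up to \<open>1 / c\<close> because the marginal has total
  mass 1.\<close>

lemma d1'_ge:
  assumes B: "finite B" "B \<noteq> {}" "f ` A \<subseteq> B" and c: "c > 0"
  shows "2 * (measure_pmf.prob Q (heavy Q (c / card B)) - 1 / c) \<le> d1' B E f Q"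
proof -
  let ?r = "pmf (map_pmf snd Q)"
  let ?S = "\<lambda>e. {a. a \<in> A \<and> pmf Q (a, e) > c / card B * (\<Sum>a\<in>A. pmf Q (a, e))}"
  have "(\<Sum>e\<in>E. 2 * ((\<Sum>a\<in>?S e. pmf Q (a, e)) - (\<Sum>a\<in>A. pmf Q (a, e)) / c))
      \<le> (\<Sum>e\<in>E. \<Sum>b\<in>B. \<bar>(\<Sum>a | a \<in> A \<and> f a = b. pmf Q (a, e)) - (\<Sum>a\<in>A. pmf Q (a, e)) / card B\<bar>)"
    using fin B c by (intro sum_mono sum_deviation_ge) auto
  also have "\<dots> = d1' B E f Q" unfolding d1'_alt pmf_map_snd by (rule sum.swap)
  also have "(\<Sum>e\<in>E. 2 * ((\<Sum>a\<in>?S e. pmf Q (a, e)) - (\<Sum>a\<in>A. pmf Q (a, e)) / c))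
      = 2 * ((\<Sum>e\<in>E. \<Sum>a\<in>?S e. pmf Q (a, e)) - (\<Sum>e\<in>E. ?r e) / c)"
    by (simp add: sum_subtractf pmf_map_snd flip: sum_distrib_left sum_divide_distrib)
  also have "(\<Sum>e\<in>E. \<Sum>a\<in>?S e. pmf Q (a, e)) = measure_pmf.prob Q (heavy Q (c / card B))"
  proof -
    have "(\<Sum>a\<in>?S e. pmf Q (a, e)) = (\<Sum>a\<in>A. if (a, e) \<in> heavy Q (c / card B) then pmf Q (a, e) else 0)" for e
      using fin sum.inter_filter[of A "\<lambda>a. pmf Q (a, e)" "\<lambda>a. (a, e) \<in> heavy Q (c / card B)"]
      by (simp add: heavy_def pmf_map_snd)
    then show ?thesis unfolding prob_heavy by (subst sum.swap) (simp only:)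
  qed
  finally show ?thesis by (simp add: sum_pmf_map_snd)
qed

lemma d1'_le:
  assumes B: "finite B" "B \<noteq> {}" "f ` A \<subseteq> B"
  shows "d1' B E f Q \<le> 2 * measure_pmf.prob Q (heavy Q c)
    + sqrt (collision_excess A E (real (card B)) (light_part Q c) (pmf (map_pmf snd Q)) f)"
proof -
  have "(\<Sum>a\<in>A. \<Sum>e\<in>E. pmf Q (a, e) - light_part Q c a e) = measure_pmf.prob Q (heavy Q c)"
    unfolding prob_heavy by (intro sum.cong refl) (auto simp: light_part_def)
  moreover have "d1' B E f Q \<le> 2 * (\<Sum>a\<in>A. \<Sum>e\<in>E. pmf Q (a, e) - light_part Q c a e)
      + sqrt (collision_excess A E (real (card B)) (light_part Q c) (pmf (map_pmf snd Q)) f)"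
    unfolding d1'_alt using fin B
    by (intro sum_deviation_le) (auto simp: pmf_map_snd[symmetric] sum_pmf_map_snd light_part_def)
  ultimately show ?thesis by simp
qed

text \<open>With the negative threshold \<open>-1\<close> every point of positive mass is heavy, the
  light part vanishes, and the general upper bound leaves only twice a probability.\<close>

lemma d1'_le_2:
  assumes B: "finite B" "B \<noteq> {}" "f ` A \<subseteq> B"
  shows "d1' B E f Q \<le> 2"
proof -
  have "(a, e) \<in> heavy Q (-1) \<or> pmf Q (a, e) = 0" for a e
    using pmf_nonneg[of Q "(a, e)"] pmf_nonneg[of "map_pmf snd Q" e]
    unfolding heavy_def mem_Collect_eq snd_conv by linarith
  then have "light_part Q (-1) a e = 0" for a e by (auto simp: light_part_def)
  then have z: "collision_excess A E (real (card B)) (light_part Q (-1)) (pmf (map_pmf snd Q)) f = 0"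
    by (simp add: collision_excess_def)
  then show ?thesis
    using d1'_le[OF B, of "- 1", unfolded z real_sqrt_zero] measure_pmf.prob_le_1[of Q "heavy Q (- 1)"]
    by linarith
qed

text \<open>One factor of the square is at most \<open>c\<close> times the marginal, which cancels
  the denominator; the other is at most the joint probability, whose total is 1.\<close>

lemma sum_light_part_square_le:
  assumes "c \<ge> 0"
  shows "(\<Sum>e\<in>E. (\<Sum>a\<in>A. (light_part Q c a e)\<^sup>2) / pmf (map_pmf snd Q) e) \<le> c"
proof -
  let ?r = "pmf (map_pmf snd Q)"
  have "(light_part Q c a e)\<^sup>2 / ?r e \<le> c * pmf Q (a, e)" for a e
  proof (cases "?r e = 0")
    case False
    then have r: "?r e > 0" by (simp add: pmf_pos)
    have "(light_part Q c a e)\<^sup>2 \<le> (c * ?r e) * pmf Q (a, e)"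
      unfolding power2_eq_square using assms
      by (intro mult_mono) (auto simp: light_part_def heavy_def not_less)
    then show ?thesis using r by (simp add: divide_le_eq mult_ac)
  qed (use assms in simp)
  then have "(\<Sum>e\<in>E. (\<Sum>a\<in>A. (light_part Q c a e)\<^sup>2) / ?r e) \<le> (\<Sum>e\<in>E. \<Sum>a\<in>A. c * pmf Q (a, e))"
    unfolding sum_divide_distrib by (intro sum_mono)
  also have "\<dots> = c" by (simp add: sum_pmf_map_snd flip: sum_distrib_left pmf_map_snd)
  finally show ?thesis .
qed

text \<open>The excess is linear in the kernel \<open>w a e * w a' e / r e\<close>. Summing this
  over \<open>e\<close> before choosing the map yields one map that serves all side information at
  once. For the greedy map the full double sum cancels against the subtracted squares, and the
  diagonal that remains is a sum of squares of light masses.\<close>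

lemma ex_map_d1'_le:
  fixes c :: real
  assumes B: "finite B" "B \<noteq> {}" and c: "c \<ge> 0"
  shows "\<exists>f\<in>A \<rightarrow>\<^sub>E B. d1' B E f Q \<le> 2 * measure_pmf.prob Q (heavy Q c) + sqrt (card B * c)"
proof -
  let ?r = "pmf (map_pmf snd Q)" and ?w = "light_part Q c"
  define M where "M = real (card B)"
  define K where "K a a' = (\<Sum>e\<in>E. ?w a e * ?w a' e / ?r e)" for a a'
  obtain f where f: "f \<in> A \<rightarrow> B"
    "M * (\<Sum>a\<in>A. \<Sum>a'\<in>A. K a a' * of_bool (f a = f a'))
     \<le> (M - 1) * (\<Sum>a\<in>A. K a a) + (\<Sum>a\<in>A. \<Sum>a'\<in>A. K a a')"
    using ex_map_few_collisions[OF fin(1) B, of K] by (auto simp: M_def)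
  have K0: "0 \<le> (\<Sum>a\<in>A. K a a)"
    unfolding K_def by (intro sum_nonneg divide_nonneg_nonneg mult_nonneg_nonneg light_part_nonneg pmf_nonneg)
  have K_sum: "(\<Sum>e\<in>E. (\<Sum>a\<in>A. \<Sum>a'\<in>A. ?w a e * ?w a' e * h a a') / ?r e) = (\<Sum>a\<in>A. \<Sum>a'\<in>A. K a a' * h a a')"
    for h :: "'a \<Rightarrow> 'a \<Rightarrow> real"
  proof -
    have "(\<Sum>e\<in>E. (\<Sum>a\<in>A. \<Sum>a'\<in>A. ?w a e * ?w a' e * h a a') / ?r e)
        = (\<Sum>a\<in>A. \<Sum>e\<in>E. \<Sum>a'\<in>A. ?w a e * ?w a' e * h a a' / ?r e)"
      unfolding sum_divide_distrib by (rule sum.swap)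
    also have "\<dots> = (\<Sum>a\<in>A. \<Sum>a'\<in>A. \<Sum>e\<in>E. ?w a e * ?w a' e * h a a' / ?r e)"
      by (intro sum.cong[OF refl] sum.swap)
    finally show ?thesis by (simp add: K_def sum_distrib_right)
  qed
  have "collision_excess A E M ?w ?r f
      = (\<Sum>e\<in>E. M * ((\<Sum>a\<in>A. \<Sum>a'\<in>A. ?w a e * ?w a' e * of_bool (f a = f a')) / ?r e)
          - (\<Sum>a\<in>A. \<Sum>a'\<in>A. ?w a e * ?w a' e * 1) / ?r e)"
    by (simp only: collision_excess_def diff_divide_distrib power2_eq_square sum_product mult_1_right times_divide_eq_right)
  also have "\<dots> = M * (\<Sum>a\<in>A. \<Sum>a'\<in>A. K a a' * of_bool (f a = f a')) - (\<Sum>a\<in>A. \<Sum>a'\<in>A. K a a' * 1)"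
    unfolding sum_subtractf sum_distrib_left[symmetric] K_sum ..
  also have "\<dots> \<le> M * (\<Sum>a\<in>A. K a a)" using f K0 by (simp add: algebra_simps)
  also have "(\<Sum>a\<in>A. K a a) = (\<Sum>e\<in>E. (\<Sum>a\<in>A. (?w a e)\<^sup>2) / ?r e)"
    unfolding K_def sum_divide_distrib power2_eq_square by (rule sum.swap)
  also have "M * \<dots> \<le> M * c"
    using sum_light_part_square_le[OF c] by (intro mult_left_mono) (auto simp: M_def)
  finally have "sqrt (collision_excess A E M ?w ?r f) \<le> sqrt (M * c)" by simp
  moreover have "f ` A \<subseteq> B" using f by auto
  ultimately have "d1' B E f Q \<le> 2 * measure_pmf.prob Q (heavy Q c) + sqrt (M * c)"
    using d1'_le[OF B, of f c] unfolding M_def by linarith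
  then show ?thesis using f by (intro bexI[of _ "restrict f A"]) (auto simp: M_def d1'_restrict)
qed

end

section \<open>Averaging over a random linear map\<close>

lemma (in prob_space) expectation_sqrt_le:
  assumes "integrable M Y" "AE x in M. 0 \<le> Y x" "expectation Y \<le> s"
  shows "expectation (\<lambda>x. sqrt (Y x)) \<le> sqrt s"
proof -
  have sq: "AE x in M. (sqrt (Y x))\<^sup>2 = Y x" using assms(2) by eventually_elim simp
  have meas: "Y \<in> borel_measurable M" using assms(1) by auto
  have meas2: "(\<lambda>x. sqrt (Y x)) \<in> borel_measurable M" using meas by measurable
  then have meas3: "(\<lambda>x. (sqrt (Y x))\<^sup>2) \<in> borel_measurable M" by measurable
  have int2: "integrable M (\<lambda>x. (sqrt (Y x))\<^sup>2)"
    by (rule iffD2[OF integrable_cong_AE[OF meas3 meas sq] assms(1)])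
  have int1: "integrable M (\<lambda>x. sqrt (Y x))"
    by (rule square_integrable_imp_integrable[OF meas2 int2])
  \<comment> \<open>Jensen's inequality for the square root, in the form that the variance of
    \<open>sqrt Y\<close> is nonnegative.\<close>
  have "(expectation (\<lambda>x. sqrt (Y x)))\<^sup>2 \<le> expectation (\<lambda>x. (sqrt (Y x))\<^sup>2)"
    using variance_positive[of "\<lambda>x. sqrt (Y x)"] variance_eq[OF int1 int2] by simp
  also have "\<dots> = expectation Y" by (rule integral_cong_AE[OF meas3 meas sq])
  finally show ?thesis using assms(3) by (intro real_le_rsqrt) simp
qed

text \<open>Seeds whose map is not onto are charged the bound 2, which gives the first term. For the
  others the pointwise bound is the square root of the excess, and only the expectation of the
  excess is known; Jensen's inequality moves the root outside.\<close>

lemma expectation_d1'_le: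
  fixes h :: "'s \<Rightarrow> 'f::{field,finite} vec \<Rightarrow> 'f vec" and Q :: "('f vec \<times> 'e) pmf"
  assumes adu: "almost_dual_universal2 \<epsilon> N m X h" and \<epsilon>: "\<epsilon> \<ge> 0"
    and E: "finite E" "set_pmf Q \<subseteq> carrier_vec N \<times> E" and c: "c \<ge> 0"
  shows "measure_pmf.expectation X (\<lambda>x. d1' (carrier_vec m) E (h x) Q)
    \<le> 2 * (1 - measure_pmf.prob X {x. h x ` carrier_vec N = carrier_vec m})
      + 2 * measure_pmf.prob Q (heavy Q c) + sqrt (\<epsilon> * real CARD('f) ^ m * c)"
proof -
  let ?C = "carrier_vec N :: 'f vec set" and ?B = "carrier_vec m :: 'f vec set"
  let ?r = "pmf (map_pmf snd Q)" and ?w = "light_part Q c" and ?q = "real CARD('f)"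
  have card_B: "real (card ?B) = ?q ^ m" by (simp add: card_carrier_vec)
  have B: "finite ?B" "?B \<noteq> {}" using zero_carrier_vec[of m] by (auto simp del: zero_carrier_vec)
  have finC: "finite ?C" by simp
  have lin: "h x ` ?C \<subseteq> ?B" if "x \<in> set_pmf X" for x
    using adu that linear_map_vecD(1)[of N m "h x"] by (auto simp: almost_dual_universal2_def)
  let ?on = "\<lambda>x. h x ` ?C = ?B"
  define Ex where "Ex x e = ?q ^ m * (\<Sum>a\<in>?C. \<Sum>a'\<in>?C. ?w a e * ?w a' e * of_bool (h x a = h x a'))
      - (\<Sum>a\<in>?C. ?w a e)\<^sup>2" for x e
  \<comment> \<open>The surjectivity indicator sets \<open>Y\<close> to 0 on the exceptional seeds,
    so the same variable can be used for all seeds.\<close>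
  define Y where "Y x = (\<Sum>e\<in>E. of_bool (?on x) * Ex x e / ?r e)" for x
  have Y_eq: "Y x = of_bool (?on x) * collision_excess ?C E (real (card ?B)) ?w ?r (h x)" for x
    by (simp add: Y_def collision_excess_def Ex_def card_B sum_distrib_left)
  have Y0: "0 \<le> Y x" if "x \<in> set_pmf X" for x
    unfolding Y_eq using lin[OF that] B by (intro mult_nonneg_nonneg collision_excess_nonneg) auto
  have intE: "integrable X (\<lambda>x. of_bool (?on x) * Ex x e)" for e
  proof (rule measure_pmf.integrable_const_bound[OF AE_I2])
    fix x
    let ?S = "\<Sum>a\<in>?C. \<Sum>a'\<in>?C. ?w a e * ?w a' e * of_bool (h x a = h x a')"
    have w: "0 \<le> ?w a e" for a by (rule light_part_nonneg)
    have "0 \<le> ?S" using w by (intro sum_nonneg) auto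
    moreover have "?S \<le> (\<Sum>a\<in>?C. \<Sum>a'\<in>?C. ?w a e * ?w a' e)"
      using w by (intro sum_mono) (auto simp: of_bool_def)
    ultimately have "\<bar>?q ^ m * ?S\<bar> \<le> ?q ^ m * (\<Sum>a\<in>?C. \<Sum>a'\<in>?C. ?w a e * ?w a' e)"
      by (simp add: abs_mult mult_left_mono)
    then have "\<bar>Ex x e\<bar> \<le> ?q ^ m * (\<Sum>a\<in>?C. \<Sum>a'\<in>?C. ?w a e * ?w a' e) + (\<Sum>a\<in>?C. ?w a e)\<^sup>2"
      unfolding Ex_def using abs_triangle_ineq4[of "?q ^ m * ?S" "(\<Sum>a\<in>?C. ?w a e)\<^sup>2"]
      by (simp only: abs_power2)
    then show "norm (of_bool (?on x) * Ex x e)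
        \<le> ?q ^ m * (\<Sum>a\<in>?C. \<Sum>a'\<in>?C. ?w a e * ?w a' e) + (\<Sum>a\<in>?C. ?w a e)\<^sup>2"
      by (cases "?on x") (auto intro: order_trans[OF abs_ge_zero])
  qed simp
  have intY: "integrable X Y"
    unfolding Y_def by (intro Bochner_Integration.integrable_sum integrable_divide_zero intE)
  have "measure_pmf.expectation X Y = (\<Sum>e\<in>E. measure_pmf.expectation X (\<lambda>x. of_bool (?on x) * Ex x e) / ?r e)"
    unfolding Y_def using intE by (subst Bochner_Integration.integral_sum) auto
  also have "\<dots> \<le> (\<Sum>e\<in>E. \<epsilon> * ?q ^ m * (\<Sum>a\<in>?C. (?w a e)\<^sup>2) / ?r e)"
    unfolding Ex_def by (intro sum_mono divide_right_mono expectation_collision_excess_le[OF adu \<epsilon>] pmf_nonneg)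
  also have "\<dots> = \<epsilon> * ?q ^ m * (\<Sum>e\<in>E. (\<Sum>a\<in>?C. (?w a e)\<^sup>2) / ?r e)"
    by (simp add: sum_distrib_left)
  also have "\<dots> \<le> \<epsilon> * ?q ^ m * c"
    using sum_light_part_square_le[OF finC E c] \<epsilon> by (intro mult_left_mono) auto
  finally have EY: "measure_pmf.expectation X (\<lambda>x. sqrt (Y x)) \<le> sqrt (\<epsilon> * ?q ^ m * c)"
    using intY Y0 by (intro measure_pmf.expectation_sqrt_le) (auto simp: AE_measure_pmf_iff)
  let ?H = "measure_pmf.prob Q (heavy Q c)"
  have bound: "d1' ?B E (h x) Q \<le> 2 * indicator {x. \<not> ?on x} x + 2 * ?H + sqrt (Y x)" if "x \<in> set_pmf X" for x
  proof (cases "?on x")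
    case True
    then show ?thesis using d1'_le[OF finC E B lin[OF that], of c] by (simp add: Y_eq)
  next
    case False
    then have "indicator {x. \<not> ?on x} x = (1 :: real)" "Y x = 0" by (auto simp: Y_eq)
    then show ?thesis
      using d1'_le_2[OF finC E B lin[OF that]] measure_nonneg[of Q "heavy Q c"]
      by (simp only: real_sqrt_zero)
  qed
  have int_sqrt: "integrable X (\<lambda>x. sqrt (Y x))"
  proof (rule Bochner_Integration.integrable_bound)
    show "integrable X (\<lambda>x. 1 + Y x)" using intY by auto
    have "sqrt y \<le> 1 + y" if "0 \<le> y" for y :: real
      using that by (intro real_le_lsqrt) (auto simp: power2_eq_square algebra_simps)
    then show "AE x in X. norm (sqrt (Y x)) \<le> norm (1 + Y x)"
      using Y0 by (auto simp: AE_measure_pmf_iff)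
  qed simp
  have int_d: "integrable X (\<lambda>x. d1' ?B E (h x) Q)"
  proof (rule measure_pmf.integrable_const_bound[where B = 2])
    have "\<bar>d1' ?B E (h x) Q\<bar> \<le> 2" if "x \<in> set_pmf X" for x
      using d1'_nonneg[of ?B E "h x" Q] d1'_le_2[OF finC E B lin[OF that]] by linarith
    then show "AE x in X. norm (d1' ?B E (h x) Q) \<le> 2" by (simp add: AE_measure_pmf_iff)
  qed simp
  have int_ind: "integrable X (indicator {x. \<not> ?on x} :: _ \<Rightarrow> real)"
    by (rule measure_pmf.integrable_const_bound[where B = 1]) auto
  have "measure_pmf.expectation X (\<lambda>x. d1' ?B E (h x) Q)
      \<le> measure_pmf.expectation X (\<lambda>x. 2 * indicator {x. \<not> ?on x} x + 2 * ?H + sqrt (Y x))"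
    using bound int_sqrt int_ind int_d by (intro integral_mono_AE) (auto simp: AE_measure_pmf_iff)
  also have "\<dots> = 2 * measure_pmf.prob X {x. \<not> ?on x} + 2 * ?H + measure_pmf.expectation X (\<lambda>x. sqrt (Y x))"
    using int_sqrt int_ind by simp
  also have "measure_pmf.prob X {x. \<not> ?on x} = 1 - measure_pmf.prob X {x. ?on x}"
    using measure_pmf.prob_compl[of "{x. ?on x}" X] by (simp add: Compl_eq_Diff_UNIV[symmetric] Collect_neg_eq)
  finally show ?thesis using EY by simp
qed

lemma expectation_d1'_ge:
  fixes h :: "'s \<Rightarrow> 'f::{field,finite} vec \<Rightarrow> 'f vec" and Q :: "('f vec \<times> 'e) pmf"
  assumes adu: "almost_dual_universal2 \<epsilon> N m X h"
    and E: "finite E" "set_pmf Q \<subseteq> carrier_vec N \<times> E" and c: "c > 0"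
  shows "2 * (measure_pmf.prob Q (heavy Q (c / real CARD('f) ^ m)) - 1 / c)
    \<le> measure_pmf.expectation X (\<lambda>x. d1' (carrier_vec m) E (h x) Q)"
proof -
  let ?C = "carrier_vec N :: 'f vec set" and ?B = "carrier_vec m :: 'f vec set"
  have B: "finite ?B" "?B \<noteq> {}" using zero_carrier_vec[of m] by (auto simp del: zero_carrier_vec)
  have finC: "finite ?C" by simp
  have lin: "h x ` ?C \<subseteq> ?B" if "x \<in> set_pmf X" for x
    using adu that linear_map_vecD(1)[of N m "h x"] by (auto simp: almost_dual_universal2_def)
  have int_d: "integrable X (\<lambda>x. d1' ?B E (h x) Q)"
  proof (rule measure_pmf.integrable_const_bound[where B = 2])
    have "\<bar>d1' ?B E (h x) Q\<bar> \<le> 2" if "x \<in> set_pmf X" for x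
      using d1'_nonneg[of ?B E "h x" Q] d1'_le_2[OF finC E B lin[OF that]] by linarith
    then show "AE x in X. norm (d1' ?B E (h x) Q) \<le> 2" by (simp add: AE_measure_pmf_iff)
  qed simp
  then show ?thesis
    using d1'_ge[OF finC E B lin c]
    by (intro measure_pmf.integral_ge_const) (auto simp: AE_measure_pmf_iff card_carrier_vec)
qed

section \<open>Second-order asymptotics\<close>

lemma pmf_replicate_pmf:
  "length xs = n \<Longrightarrow> pmf (replicate_pmf n p) xs = (\<Prod>x\<leftarrow>xs. pmf p x)"
proof (induction n arbitrary: xs)
  case 0
  then show ?case by simp
next
  case (Suc n)
  then obtain y ys where xs: "xs = y # ys" "length ys = n" by (cases xs) auto
  have "replicate_pmf (Suc n) p = map_pmf (\<lambda>z. fst z # snd z) (pair_pmf p (replicate_pmf n p))"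
    by (simp add: pair_pmf_def map_bind_pmf)
  moreover have "pmf (map_pmf (\<lambda>z. fst z # snd z) (pair_pmf p (replicate_pmf n p))) (fst (y, ys) # snd (y, ys))
      = pmf (pair_pmf p (replicate_pmf n p)) (y, ys)"
    by (rule pmf_map_inj') (auto simp: inj_def)
  ultimately show ?case using Suc.IH[OF xs(2)] by (simp add: xs(1) pmf_pair)
qed

lemma map_pmf_replicate_pmf: "map_pmf (map g) (replicate_pmf n p) = replicate_pmf n (map_pmf g p)"
proof (induction n)
  case (Suc n)
  show ?case by (simp add: map_bind_pmf bind_map_pmf flip: Suc)
qed simp

text \<open>All blocks have the same length \<open>k\<close> and their number \<open>n\<close> is
  fixed, so a concatenation can be cut back in only one way. Hence concatenating blocks preserves
  point probabilities, and those of \<open>iid_pmf\<close> are products.\<close>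

lemma inj_on_flatten_vecs:
  "inj_on (\<lambda>xs. (flatten_vecs (map fst xs), map snd xs)) {xs. length xs = n \<and> fst ` set xs \<subseteq> carrier_vec k}"
proof (rule inj_onI, clarsimp)
  fix xs ys :: "('a vec \<times> 'b) list"
  assume n: "n = length xs" "length ys = length xs"
    and carrier: "fst ` set xs \<subseteq> carrier_vec k" "fst ` set ys \<subseteq> carrier_vec k"
    and eq: "flatten_vecs (map fst xs) = flatten_vecs (map fst ys)" "map snd xs = map snd ys"
  let ?l = "map list_of_vec \<circ> map fst"
  have "concat (?l xs) = concat (?l ys)"
    using arg_cong[OF eq(1), of list_of_vec] by (simp add: flatten_vecs_def list_vec)
  moreover have "\<forall>(x, y)\<in>set (zip (?l xs) (?l ys)). length x = length y"
  proof clarify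
    fix x y assume "(x, y) \<in> set (zip (?l xs) (?l ys))"
    then have "x \<in> set (?l xs)" "y \<in> set (?l ys)" by (auto dest: set_zip_leftD set_zip_rightD)
    moreover have "length v = k" if "v \<in> set (?l zs)" "fst ` set zs \<subseteq> carrier_vec k" for v zs
      using that by auto
    ultimately show "length x = length y" using carrier by metis
  qed
  ultimately have "?l xs = ?l ys" using n by (intro concat_injective) auto
  then have "map fst xs = map fst ys"
    using vec_list by (metis comp_apply inj_on_inverseI inj_map_eq_map)
  then show "xs = ys" using eq(2) by (metis zip_map_fst_snd)
qed

lemma set_iid_pmf_subset:
  assumes "set_pmf P \<subseteq> carrier_vec k \<times> UNIV"
  shows "set_pmf (iid_pmf n P) \<subseteq> carrier_vec (k * n) \<times> {es. length es = n}"
proof -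
  have "length (concat (map list_of_vec (map fst xs))) = k * length xs" if "set xs \<subseteq> set_pmf P" for xs
    using that assms by (induction xs) auto
  then show ?thesis by (auto simp: iid_pmf_def set_replicate_pmf flatten_vecs_def lists_eq_set intro!: carrier_vecI)
qed

lemma finite_set_pmf_carrier:
  assumes "set_pmf (P :: ('f::finite vec \<times> 'e::finite) pmf) \<subseteq> carrier_vec k \<times> UNIV"
  shows "finite (set_pmf P)"
  by (rule finite_subset[OF assms]) simp

lemma cond_prob_pos:
  assumes "x \<in> set_pmf P"
  shows "0 < cond_prob P (fst x) (snd x)"
proof -
  have "snd x \<in> set_pmf (map_pmf snd P)" using assms by auto
  then show ?thesis using assms by (simp add: cond_prob_def pmf_positive)
qed

lemma cond_prob_le_1: "cond_prob P a e \<le> 1"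
proof -
  have "measure_pmf.prob P {(a, e)} \<le> measure_pmf.prob P (snd -` {e})"
    by (intro measure_pmf.finite_measure_mono) auto
  then have "pmf P (a, e) \<le> pmf (map_pmf snd P) e"
    by (simp add: pmf_map measure_pmf_single)
  then show ?thesis by (simp add: cond_prob_def divide_le_eq pmf_nonneg less_le)
qed

lemma ln_prod_list_pos:
  fixes g :: "'a \<Rightarrow> real"
  assumes "\<And>x. x \<in> set xs \<Longrightarrow> 0 < g x"
  shows "0 < (\<Prod>x\<leftarrow>xs. g x) \<and> ln (\<Prod>x\<leftarrow>xs. g x) = - (\<Sum>x\<leftarrow>xs. - ln (g x))"
  using assms
proof (induction xs)
  case (Cons x xs)
  then have "0 < g x" and "0 < (\<Prod>x\<leftarrow>xs. g x) \<and> ln (\<Prod>x\<leftarrow>xs. g x) = - (\<Sum>x\<leftarrow>xs. - ln (g x))" by auto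
  then show ?case by (simp add: ln_mult_pos)
qed simp

text \<open>Conditional probabilities of the product law factorise, so \<open>- ln\<close> turns
  heaviness into an i.i.d. sum falling below a threshold. On the support all factors are positive,
  which makes the logarithms genuine.\<close>

lemma prob_heavy_iid_pmf:
  assumes P: "set_pmf P \<subseteq> carrier_vec k \<times> UNIV" and c: "c > 0"
  shows "measure_pmf.prob (iid_pmf n P) (heavy (iid_pmf n P) c)
    = measure_pmf.prob (replicate_pmf n P) {xs. (\<Sum>x\<leftarrow>xs. - ln (cond_prob P (fst x) (snd x))) < - ln c}"
proof -
  let ?h = "\<lambda>xs. (flatten_vecs (map fst xs), map snd xs)"
  let ?W = "replicate_pmf n P"
  have W: "length xs = n" "set xs \<subseteq> set_pmf P" if "xs \<in> set_pmf ?W" for xs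
    using that by (auto simp: set_replicate_pmf)
  have inj: "inj_on ?h (set_pmf ?W)"
    by (rule inj_on_subset[OF inj_on_flatten_vecs[of n k]]) (use W P in fastforce)
  have "?h xs \<in> heavy (iid_pmf n P) c \<longleftrightarrow> (\<Sum>x\<leftarrow>xs. - ln (cond_prob P (fst x) (snd x))) < - ln c"
    if xs: "xs \<in> set_pmf ?W" for xs
  proof -
    have joint: "pmf (iid_pmf n P) (?h xs) = (\<Prod>x\<leftarrow>xs. pmf P x)"
      unfolding iid_pmf_def using pmf_map_inj[OF inj xs] pmf_replicate_pmf[OF W(1)[OF xs], of P] by simp
    have "map_pmf snd (iid_pmf n P) = replicate_pmf n (map_pmf snd P)"
      by (simp add: iid_pmf_def pmf.map_comp o_def flip: map_pmf_replicate_pmf)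
    then have marginal: "pmf (map_pmf snd (iid_pmf n P)) (snd (?h xs)) = (\<Prod>x\<leftarrow>xs. pmf (map_pmf snd P) (snd x))"
      using W(1)[OF xs] by (simp add: pmf_replicate_pmf o_def)
    have pos: "0 < pmf (map_pmf snd P) (snd x)" "0 < cond_prob P (fst x) (snd x)" if "x \<in> set xs" for x
      using that W(2)[OF xs] by (auto intro!: cond_prob_pos pmf_positive)
    have "pmf P x = cond_prob P (fst x) (snd x) * pmf (map_pmf snd P) (snd x)" if "x \<in> set xs" for x
      using pos(1)[OF that] by (simp add: cond_prob_def)
    then have "(\<Prod>x\<leftarrow>xs. pmf P x) = (\<Prod>x\<leftarrow>xs. cond_prob P (fst x) (snd x)) * (\<Prod>x\<leftarrow>xs. pmf (map_pmf snd P) (snd x))"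
      by (induction xs) auto
    moreover have "0 < (\<Prod>x\<leftarrow>xs. pmf (map_pmf snd P) (snd x))"
      using pos(1) by (induction xs) auto
    moreover have cond: "0 < (\<Prod>x\<leftarrow>xs. cond_prob P (fst x) (snd x)) \<and>
        ln (\<Prod>x\<leftarrow>xs. cond_prob P (fst x) (snd x)) = - (\<Sum>x\<leftarrow>xs. - ln (cond_prob P (fst x) (snd x)))"
      using pos(2) by (rule ln_prod_list_pos)
    ultimately have "?h xs \<in> heavy (iid_pmf n P) c \<longleftrightarrow> c < (\<Prod>x\<leftarrow>xs. cond_prob P (fst x) (snd x))"
      unfolding heavy_def mem_Collect_eq joint marginal by simp
    also have "\<dots> \<longleftrightarrow> ln c < ln (\<Prod>x\<leftarrow>xs. cond_prob P (fst x) (snd x))"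
      by (rule ln_less_cancel_iff[symmetric, OF c cond[THEN conjunct1]])
    finally show ?thesis using cond by linarith
  qed
  then show ?thesis
    by (subst iid_pmf_def) (auto intro!: measure_prob_cong_0 simp: measure_map_pmf set_pmf_iff[symmetric])
qed

section \<open>Limits for heavy points and key lengths\<close>

context
  fixes P :: "('f::{field,finite} vec \<times> 'e::finite) pmf" and k :: nat and H V :: real
  assumes P_space: "set_pmf P \<subseteq> carrier_vec k \<times> UNIV"
    and H_def: "H = cond_ent (carrier_vec k) UNIV P"
    and V_def: "V = cond_var (carrier_vec k) UNIV P"
    and V_pos: "V > 0"
begin

lemma expectation_cond_prob:
  "measure_pmf.expectation P (\<lambda>x. h (cond_prob P (fst x) (snd x)))
    = (\<Sum>a\<in>carrier_vec k. \<Sum>e\<in>UNIV. pmf P (a, e) * h (cond_prob P a e))" for h :: "real \<Rightarrow> real"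
proof -
  have "measure_pmf.expectation P (\<lambda>x. h (cond_prob P (fst x) (snd x)))
      = (\<Sum>x\<in>carrier_vec k \<times> UNIV. pmf P x *\<^sub>R h (cond_prob P (fst x) (snd x)))"
    by (rule integral_measure_pmf) (use P_space in auto)
  then show ?thesis by (simp add: sum.cartesian_product case_prod_unfold)
qed

text \<open>\<open>H\<close> is a sum of nonnegative terms; if it were 0, then \<open>- ln\<close>
  of the conditional probability would be constantly 0 on the support and \<open>V\<close> would
  vanish. Positivity makes the key size tend to infinity whatever the sign of
  \<open>R\<close>.\<close>

lemma cond_ent_pos: "H > 0"
proof (rule ccontr)
  assume "\<not> H > 0"
  define t where "t a e = pmf P (a, e) * - ln (cond_prob P a e)" for a e
  have t: "0 \<le> t a e" for a e
  proof (cases "cond_prob P a e = 0")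
    case False
    then have "ln (cond_prob P a e) \<le> 0"
      using cond_prob_le_1[of P a e] by (simp add: cond_prob_def less_le)
    then show ?thesis unfolding t_def by (intro mult_nonneg_nonneg) simp_all
  qed (simp add: t_def)
  have T: "0 \<le> (\<Sum>e\<in>UNIV. t a e)" for a by (intro sum_nonneg t)
  have H: "H = (\<Sum>a\<in>carrier_vec k. \<Sum>e\<in>UNIV. t a e)"
    by (simp add: H_def cond_ent_def sum_negf t_def)
  have "0 \<le> H" unfolding H by (intro sum_nonneg T)
  then have H0: "H = 0" using \<open>\<not> H > 0\<close> by simp
  have "(\<Sum>e\<in>UNIV. t a e) = 0" if "a \<in> carrier_vec k" for a
    using sum_nonneg_0[OF finite_carrier_vec T H[unfolded H0, symmetric] that] .
  then have "t a e = 0" if "a \<in> carrier_vec k" for a e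
    using sum_nonneg_0[where f = "t a", OF finite_class.finite_UNIV t _ UNIV_I] that by blast
  then have t0: "pmf P (a, e) = 0 \<or> ln (cond_prob P a e) = 0" if "a \<in> carrier_vec k" for a e
    using that by (simp add: t_def)
  have "V = 0"
    unfolding V_def cond_var_def H_def[symmetric] H0
    using t0 by (intro sum.neutral ballI) (simp add: power2_eq_square)
  then show False using V_pos by simp
qed

text \<open>Passing to logarithms, the error \<open>K\<close> and the factor \<open>n powr s\<close>
  move the threshold by \<open>O(1)\<close> and \<open>O(ln n)\<close>, both negligible after
  division by \<open>sqrt n\<close>. Allowing any \<open>s\<close> and any \<open>L\<close> lets one
  limit serve upper and lower bounds, for \<open>M n\<close> as well as for
  \<open>q ^ m n\<close>.\<close>

lemma prob_heavy_iid_pmf_tendsto: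
  fixes L :: "nat \<Rightarrow> real" and R s K :: real
  assumes L: "eventually (\<lambda>n. L n > 0 \<and> \<bar>ln (L n) - (n * H + sqrt n * R)\<bar> \<le> K) sequentially"
  shows "(\<lambda>n. measure_pmf.prob (iid_pmf n P) (heavy (iid_pmf n P) (n powr s / L n)))
    \<longlonglongrightarrow> (LBINT x:{..R / sqrt V}. 1 / sqrt (2 * pi) * exp (- x\<^sup>2 / 2))"
proof -
  define t where "t n = ln (L n) - s * ln n" for n :: nat
  let ?g = "\<lambda>x. - ln (cond_prob P (fst x) (snd x))"
  have L': "eventually (\<lambda>n. n > 0 \<and> L n > 0 \<and> \<bar>ln (L n) - (n * H + sqrt n * R)\<bar> \<le> K) sequentially"
    using L eventually_gt_at_top[of 0] by eventually_elim auto
  have t: "(\<lambda>n. (t n - n * H) / sqrt n) \<longlonglongrightarrow> R"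
  proof (rule tendsto_sandwich)
    show "eventually (\<lambda>n. R - K / sqrt n - s * ln n / sqrt n \<le> (t n - n * H) / sqrt n) sequentially"
      using L'
    proof eventually_elim
      case (elim n)
      then have "(n * H + sqrt n * R - K - s * ln n - n * H) / sqrt n \<le> (t n - n * H) / sqrt n"
        by (intro divide_right_mono) (auto simp: t_def)
      then show ?case using elim by (simp add: diff_divide_distrib add_divide_distrib)
    qed
    show "eventually (\<lambda>n. (t n - n * H) / sqrt n \<le> R + K / sqrt n - s * ln n / sqrt n) sequentially"
      using L'
    proof eventually_elim
      case (elim n)
      then have "(t n - n * H) / sqrt n \<le> (n * H + sqrt n * R + K - s * ln n - n * H) / sqrt n"
        by (intro divide_right_mono) (auto simp: t_def)
      then show ?case using elim by (simp add: diff_divide_distrib add_divide_distrib)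
    qed
    show "(\<lambda>n. R - K / sqrt n - s * ln n / sqrt n) \<longlonglongrightarrow> R" by real_asymp
    show "(\<lambda>n. R + K / sqrt n - s * ln n / sqrt n) \<longlonglongrightarrow> R" by real_asymp
  qed
  have "(\<lambda>n. measure_pmf.prob (replicate_pmf n P) {xs. (\<Sum>x\<leftarrow>xs. ?g x) < t n})
      \<longlonglongrightarrow> (LBINT x:{..R / sqrt V}. 1 / sqrt (2 * pi) * exp (- x\<^sup>2 / 2))"
  proof (rule prob_sum_list_less_tendsto[OF finite_set_pmf_carrier[OF P_space] _ _ V_pos t])
    show "measure_pmf.expectation P ?g = H"
      using expectation_cond_prob[of "\<lambda>y. - ln y"] by (simp add: H_def cond_ent_def sum_negf)
    show "measure_pmf.expectation P (\<lambda>x. (?g x - H)\<^sup>2) = V"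
      using expectation_cond_prob[of "\<lambda>y. (- ln y - H)\<^sup>2"] by (simp add: V_def cond_var_def H_def)
  qed
  moreover have "eventually (\<lambda>n. measure_pmf.prob (replicate_pmf n P) {xs. (\<Sum>x\<leftarrow>xs. ?g x) < t n}
      = measure_pmf.prob (iid_pmf n P) (heavy (iid_pmf n P) (n powr s / L n))) sequentially"
    using L'
  proof eventually_elim
    case (elim n)
    then have "n powr s / L n > 0" "- ln (n powr s / L n) = t n" by (auto simp: t_def ln_div ln_powr)
    then show ?case using prob_heavy_iid_pmf[OF P_space, of "n powr s / L n" n] by simp
  qed
  ultimately show ?thesis by (rule Lim_transform_eventually)
qed

lemma key_size_asymp:
  "eventually (\<lambda>n. real (key_size H R n) \<ge> 1 \<and>
     \<bar>ln (real (key_size H R n)) - (n * H + sqrt n * R)\<bar> \<le> ln 2) sequentially"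
proof -
  have "filterlim (\<lambda>n. exp (real n * H + sqrt (real n) * R)) at_top sequentially"
    using cond_ent_pos by real_asymp
  \<comment> \<open>Once \<open>x\<close> is at least 2, its floor is at least \<open>x / 2\<close>;
    this is the origin of the constant \<open>ln 2\<close>.\<close>
  then have "eventually (\<lambda>n. 2 \<le> exp (real n * H + sqrt (real n) * R)) sequentially"
    by (simp add: filterlim_at_top)
  then show ?thesis
  proof eventually_elim
    case (elim n)
    define x where "x = exp (real n * H + sqrt (real n) * R)"
    have M: "real (key_size H R n) = real_of_int \<lfloor>x\<rfloor>" using elim by (simp add: key_size_def x_def)
    have 1: "x / 2 \<le> real (key_size H R n)" "real (key_size H R n) \<le> x" "1 \<le> real (key_size H R n)"
      unfolding M using elim x_def by linarith+
    then have "ln (x / 2) \<le> ln (real (key_size H R n))" "ln (real (key_size H R n)) \<le> ln x"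
      using elim x_def by (subst ln_le_cancel_iff; linarith)+
    moreover have "ln (x / 2) = ln x - ln 2" using elim x_def by (simp add: ln_div)
    moreover have "ln x = real n * H + sqrt (real n) * R" by (simp add: x_def)
    ultimately show ?case using 1 by linarith
  qed
qed

text \<open>Rounding the logarithm to base \<open>q\<close> down loses at most 1, so the power of
  \<open>q\<close> is within a factor \<open>q\<close> of the key size. This adds
  \<open>ln q\<close> to the error.\<close>

lemma power_key_dim_asymp:
  "eventually (\<lambda>n. real CARD('f) ^ key_dim CARD('f) (key_size H R n) > 0 \<and>
     \<bar>ln (real CARD('f) ^ key_dim CARD('f) (key_size H R n)) - (n * H + sqrt n * R)\<bar>
       \<le> ln 2 + ln (real CARD('f))) sequentially"
  using key_size_asymp[of R]
proof eventually_elim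
  case (elim n)
  let ?q = "real CARD('f)" and ?M = "real (key_size H R n)"
  have q: "?q \<ge> 2" using card_field_ge_2[where 'f = 'f] by simp
  have lnq: "ln ?q > 0" using q by simp
  define d where "d = key_dim CARD('f) (key_size H R n)"
  have "log ?q ?M \<ge> 0" using q elim by simp
  then have "real d = real_of_int \<lfloor>log ?q ?M\<rfloor>" by (simp add: d_def key_dim_def)
  then have "real d \<le> log ?q ?M" "log ?q ?M - 1 \<le> real d" by linarith+
  then have "real d * ln ?q \<le> log ?q ?M * ln ?q" "(log ?q ?M - 1) * ln ?q \<le> real d * ln ?q"
    using lnq by (auto intro: mult_right_mono)
  moreover have "log ?q ?M * ln ?q = ln ?M" "(log ?q ?M - 1) * ln ?q = ln ?M - ln ?q"
    using lnq by (simp_all add: log_def field_simps)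
  moreover have "ln (?q ^ d) = real d * ln ?q" by (rule ln_realpow)
  ultimately have "ln (?q ^ d) \<le> ln ?M" "ln ?M - ln ?q \<le> ln (?q ^ d)" by simp_all
  moreover have "\<bar>a - z\<bar> \<le> b + c" if "a \<le> l" "l - c \<le> a" "\<bar>l - z\<bar> \<le> b" "0 < c" for a b c l z :: real
    using that by linarith
  moreover have "?q ^ d > 0" using q by simp
  ultimately show ?case using elim[THEN conjunct2] lnq unfolding d_def by blast
qed

end

lemma poly_mult_powr_degree_tendsto_0: "(\<lambda>n. poly p (real n) * real n powr - real (Suc (degree p))) \<longlonglongrightarrow> 0"
proof -
  have "((\<lambda>x. poly p x / poly (monom 1 (Suc (degree p))) x) \<longlongrightarrow> 0) at_infinity"
    by (rule poly_divide_tendsto_0_at_infinity) (simp add: degree_monom_eq)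
  then have "(\<lambda>n. poly p (real n) / poly (monom 1 (Suc (degree p))) (real n)) \<longlonglongrightarrow> 0"
    by (rule filterlim_compose) (rule filterlim_at_top_imp_at_infinity[OF filterlim_real_sequentially])
  then show ?thesis
    by (rule Lim_transform_eventually)
      (use eventually_gt_at_top[of 0] in \<open>eventually_elim, simp add: poly_monom powr_minus powr_realpow divide_inverse del: of_nat_Suc power_Suc\<close>)
qed

text \<open>The linear maps take values in a space of \<open>q ^ m n\<close> elements, while the
  minimum is over maps into the full range of \<open>M n\<close> values; both sizes agree to second
  order. Universality is assumed for those \<open>n\<close> with \<open>m n \<le> k * n\<close>,
  since its definition includes this inequality; for large \<open>n\<close> the inequality follows
  from \<open>onto\<close>.\<close>

theorem theorem25:
  fixes k :: nat
    and P :: "('f::{field,finite} vec \<times> 'e::finite) pmf"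
    and R H V :: real
    and p :: "real poly"
    and X :: "nat \<Rightarrow> 's pmf"
    and f :: "nat \<Rightarrow> 's \<Rightarrow> 'f vec \<Rightarrow> 'f vec"
    and M m :: "nat \<Rightarrow> nat"
  assumes P_space: "set_pmf P \<subseteq> carrier_vec k \<times> UNIV"
    and H_def: "H = cond_ent (carrier_vec k) UNIV P"
    and V_def: "V = cond_var (carrier_vec k) UNIV P"
    and V_pos: "V > 0"
    and p_pos: "\<And>n. n \<ge> 1 \<Longrightarrow> poly p (real n) > 0"
    and M_def: "\<And>n. M n = key_size H R n"
    and m_def: "\<And>n. m n = key_dim CARD('f) (M n)"
    and dual_universal: "\<And>n. n \<ge> 1 \<Longrightarrow> m n \<le> k * n \<Longrightarrow>
          almost_dual_universal2 (poly p (real n)) (k * n) (m n) (X n) (f n)"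
    and onto: "(\<lambda>n. measure_pmf.prob (X n)
          {x. f n x ` carrier_vec (k * n) = carrier_vec (m n)}) \<longlonglongrightarrow> 1"
  shows "(\<lambda>n. measure_pmf.expectation (X n)
            (\<lambda>x. d1' (carrier_vec (m n)) {es. length es = n} (f n x) (iid_pmf n P)))
           \<longlonglongrightarrow> 2 * (LBINT x:{..R / sqrt V}. 1 / sqrt (2 * pi) * exp (- x\<^sup>2 / 2))
       \<and> (\<lambda>n. Min ((\<lambda>g. d1' {1..M n} {es. length es = n} g (iid_pmf n P))
              ` (carrier_vec (k * n) \<rightarrow>\<^sub>E {1..M n})))
           \<longlonglongrightarrow> 2 * (LBINT x:{..R / sqrt V}. 1 / sqrt (2 * pi) * exp (- x\<^sup>2 / 2))"
proof
  let ?q = "real CARD('f)" and ?E = "\<lambda>n. {es :: 'e list. length es = n}" and ?Q = "\<lambda>n. iid_pmf n P"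
  let ?\<Phi> = "LBINT x:{..R / sqrt V}. 1 / sqrt (2 * pi) * exp (- x\<^sup>2 / 2)"
  note setting = P_space H_def V_def V_pos
  have E: "finite (?E n)" for n
    using finite_lists_length_eq[of "UNIV :: 'e set" n] by simp
  note Q = set_iid_pmf_subset[OF P_space]
  have finC: "finite (carrier_vec N :: 'f vec set)" for N by simp
  have inv: "(\<lambda>n. 1 / real n) \<longlonglongrightarrow> 0" by real_asymp
  have M_asymp: "eventually (\<lambda>n. real (M n) > 0 \<and> \<bar>ln (real (M n)) - (n * H + sqrt n * R)\<bar> \<le> ln 2) sequentially"
    using key_size_asymp[OF setting, of R] unfolding M_def by eventually_elim simp
  have m_asymp: "eventually (\<lambda>n. ?q ^ m n > 0 \<and>
      \<bar>ln (?q ^ m n) - (n * H + sqrt n * R)\<bar> \<le> ln 2 + ln ?q) sequentially"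
    using power_key_dim_asymp[OF setting, of R] unfolding m_def M_def .

  show "(\<lambda>n. measure_pmf.expectation (X n)
            (\<lambda>x. d1' (carrier_vec (m n)) (?E n) (f n x) (?Q n))) \<longlonglongrightarrow> 2 * ?\<Phi>"
  proof (rule tendsto_sandwich)
    let ?on = "\<lambda>n. measure_pmf.prob (X n) {x. f n x ` carrier_vec (k * n) = carrier_vec (m n)}"
    \<comment> \<open>A positive probability yields at least one surjection, and comparing
      cardinalities then gives \<open>m n \<le> k * n\<close>, the condition under which
      universality is available.\<close>
    have "eventually (\<lambda>n. ?on n > 0) sequentially"
      using order_tendstoD(1)[OF onto, of 0] by simp
    then have "eventually (\<lambda>n. m n \<le> k * n) sequentially"
    proof eventually_elim
      case (elim n)
      then obtain x where "f n x ` carrier_vec (k * n) = carrier_vec (m n)"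
        using measure_empty[of "X n"] by (metis (mono_tags, lifting) Collect_empty_eq less_irrefl)
      then have "CARD('f) ^ m n \<le> CARD('f) ^ (k * n)"
        using card_image_le[OF finC, of "f n x" "k * n"] by (simp add: card_carrier_vec)
      then show ?case using card_field_ge_2[where 'f = 'f] by (simp add: power_increasing_iff)
    qed
    then have adu: "eventually (\<lambda>n. n \<ge> 1 \<and> ?q ^ m n > 0 \<and> almost_dual_universal2 (poly p (real n)) (k * n) (m n) (X n) (f n)) sequentially"
      using eventually_ge_at_top[of 1] m_asymp by eventually_elim (use dual_universal in auto)
    show "eventually (\<lambda>n. 2 * (measure_pmf.prob (?Q n) (heavy (?Q n) (n powr 1 / ?q ^ m n)) - 1 / n)
        \<le> measure_pmf.expectation (X n) (\<lambda>x. d1' (carrier_vec (m n)) (?E n) (f n x) (?Q n))) sequentially"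
      using adu
    proof eventually_elim
      case (elim n)
      then have "almost_dual_universal2 (poly p (real n)) (k * n) (m n) (X n) (f n)" by simp
      from expectation_d1'_ge[OF this E Q, of "real n"] show ?case using elim by simp
    qed
    have "(\<lambda>n. 2 * (measure_pmf.prob (?Q n) (heavy (?Q n) (n powr 1 / ?q ^ m n)) - 1 / n)) \<longlonglongrightarrow> 2 * (?\<Phi> - 0)"
      by (intro tendsto_intros prob_heavy_iid_pmf_tendsto[OF setting m_asymp] inv)
    then show "(\<lambda>n. 2 * (measure_pmf.prob (?Q n) (heavy (?Q n) (n powr 1 / ?q ^ m n)) - 1 / n)) \<longlonglongrightarrow> 2 * ?\<Phi>" by simp
    let ?s = "- real (Suc (degree p))"
    show "eventually (\<lambda>n. measure_pmf.expectation (X n) (\<lambda>x. d1' (carrier_vec (m n)) (?E n) (f n x) (?Q n))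
        \<le> 2 * (1 - ?on n) + 2 * measure_pmf.prob (?Q n) (heavy (?Q n) (n powr ?s / ?q ^ m n))
          + sqrt (poly p (real n) * n powr ?s)) sequentially"
      using adu
    proof eventually_elim
      case (elim n)
      have "poly p (real n) \<ge> 0" using p_pos[of n] elim by simp
      then have "measure_pmf.expectation (X n) (\<lambda>x. d1' (carrier_vec (m n)) (?E n) (f n x) (?Q n))
          \<le> 2 * (1 - ?on n) + 2 * measure_pmf.prob (?Q n) (heavy (?Q n) (n powr ?s / ?q ^ m n))
            + sqrt (poly p (real n) * ?q ^ m n * (n powr ?s / ?q ^ m n))"
        using elim by (intro expectation_d1'_le E Q) auto
      also have "poly p (real n) * ?q ^ m n * (n powr ?s / ?q ^ m n) = poly p (real n) * n powr ?s"
        using elim by simp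
      finally show ?case .
    qed
    have "(\<lambda>n. 2 * (1 - ?on n) + 2 * measure_pmf.prob (?Q n) (heavy (?Q n) (n powr ?s / ?q ^ m n))
          + sqrt (poly p (real n) * n powr ?s)) \<longlonglongrightarrow> 2 * (1 - 1) + 2 * ?\<Phi> + sqrt 0"
      by (intro tendsto_intros onto prob_heavy_iid_pmf_tendsto[OF setting m_asymp] poly_mult_powr_degree_tendsto_0)
    then show "(\<lambda>n. 2 * (1 - ?on n) + 2 * measure_pmf.prob (?Q n) (heavy (?Q n) (n powr ?s / ?q ^ m n))
          + sqrt (poly p (real n) * n powr ?s)) \<longlonglongrightarrow> 2 * ?\<Phi>" by simp
  qed

  show "(\<lambda>n. Min ((\<lambda>g. d1' {1..M n} (?E n) g (?Q n)) ` (carrier_vec (k * n) \<rightarrow>\<^sub>E {1..M n}))) \<longlonglongrightarrow> 2 * ?\<Phi>"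
  proof (rule tendsto_sandwich)
    have big: "eventually (\<lambda>n. n \<ge> 1 \<and> M n \<ge> 1) sequentially"
      using eventually_ge_at_top[of 1] M_asymp by eventually_elim auto
    have fin: "finite (carrier_vec (k * n) \<rightarrow>\<^sub>E {1..M n} :: ('f vec \<Rightarrow> nat) set)" for n
      by (intro finite_PiE) auto
    \<comment> \<open>Here \<open>powr\<close> binds tighter than division: the threshold is
      \<open>1 / n\<close> divided by \<open>M n\<close>, so the collision term is the square root
      of \<open>1 / n\<close>.\<close>
    have ex: "\<exists>g\<in>carrier_vec (k * n) \<rightarrow>\<^sub>E {1..M n}. d1' {1..M n} (?E n) g (?Q n)
        \<le> 2 * measure_pmf.prob (?Q n) (heavy (?Q n) (n powr - 1 / M n)) + sqrt (M n * (n powr - 1 / M n))"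
      if "M n \<ge> 1" for n
      using ex_map_d1'_le[OF finC E Q, where B = "{1..M n}" and c = "n powr - 1 / M n"] that by simp
    show "eventually (\<lambda>n. 2 * (measure_pmf.prob (?Q n) (heavy (?Q n) (n powr 1 / M n)) - 1 / n)
        \<le> Min ((\<lambda>g. d1' {1..M n} (?E n) g (?Q n)) ` (carrier_vec (k * n) \<rightarrow>\<^sub>E {1..M n}))) sequentially"
      using big
    proof eventually_elim
      case (elim n)
      have "2 * (measure_pmf.prob (?Q n) (heavy (?Q n) (n powr 1 / M n)) - 1 / n) \<le> d1' {1..M n} (?E n) g (?Q n)"
        if "g \<in> carrier_vec (k * n) \<rightarrow>\<^sub>E {1..M n}" for g
        using d1'_ge[OF finC E Q, where B = "{1..M n}" and f = g and c = "real n"] that elim by (auto simp: PiE_def image_subset_iff Pi_iff)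
      \<comment> \<open>The greedy map also witnesses that the set of maps is nonempty, without
        which \<open>Min\<close> carries no information.\<close>
      then show ?case using fin ex[of n] elim by (subst Min_ge_iff) auto
    qed
    have "(\<lambda>n. 2 * (measure_pmf.prob (?Q n) (heavy (?Q n) (n powr 1 / M n)) - 1 / n)) \<longlonglongrightarrow> 2 * (?\<Phi> - 0)"
      by (intro tendsto_intros prob_heavy_iid_pmf_tendsto[OF setting M_asymp] inv)
    then show "(\<lambda>n. 2 * (measure_pmf.prob (?Q n) (heavy (?Q n) (n powr 1 / M n)) - 1 / n)) \<longlonglongrightarrow> 2 * ?\<Phi>" by simp
    show "eventually (\<lambda>n. Min ((\<lambda>g. d1' {1..M n} (?E n) g (?Q n)) ` (carrier_vec (k * n) \<rightarrow>\<^sub>E {1..M n}))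
        \<le> 2 * measure_pmf.prob (?Q n) (heavy (?Q n) (n powr - 1 / M n)) + sqrt (1 / n)) sequentially"
      using big
    proof eventually_elim
      case (elim n)
      then obtain g where g: "g \<in> carrier_vec (k * n) \<rightarrow>\<^sub>E {1..M n}"
        "d1' {1..M n} (?E n) g (?Q n)
          \<le> 2 * measure_pmf.prob (?Q n) (heavy (?Q n) (n powr - 1 / M n)) + sqrt (M n * (n powr - 1 / M n))"
        using ex[of n] by blast
      have "M n * (n powr - 1 / M n) = 1 / n" using elim by (simp add: powr_minus divide_inverse)
      then have "d1' {1..M n} (?E n) g (?Q n)
          \<le> 2 * measure_pmf.prob (?Q n) (heavy (?Q n) (n powr - 1 / M n)) + sqrt (1 / n)" using g(2) by simp
      moreover have "Min ((\<lambda>g. d1' {1..M n} (?E n) g (?Q n)) ` (carrier_vec (k * n) \<rightarrow>\<^sub>E {1..M n}))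
          \<le> d1' {1..M n} (?E n) g (?Q n)"
        using g(1) fin by (intro Min_le) auto
      ultimately show ?case by linarith
    qed
    have "(\<lambda>n. 2 * measure_pmf.prob (?Q n) (heavy (?Q n) (n powr - 1 / M n)) + sqrt (1 / n)) \<longlonglongrightarrow> 2 * ?\<Phi> + sqrt 0"
      by (intro tendsto_intros prob_heavy_iid_pmf_tendsto[OF setting M_asymp] inv)
    then show "(\<lambda>n. 2 * measure_pmf.prob (?Q n) (heavy (?Q n) (n powr - 1 / M n)) + sqrt (1 / n)) \<longlonglongrightarrow> 2 * ?\<Phi>" by simp
  qed
qed

end
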